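(* For every $n$, the product $\mu$ on $\widetilde{AM}{}_n^{fr}$, written $\phi\cdot\psi=\mu(\phi,\psi)$, is homotopy commutative: $\phi\cdot\psi$ is homotopic to $\psi\cdot\phi$, i.e. the maps $(\phi,\psi)\mapsto\phi\cdot\psi$ and $(\phi,\psi)\mapsto\psi\cdot\phi$ from $\widetilde{AM}{}_n^{fr}\times\widetilde{AM}{}_n^{fr}$ to $\widetilde{AM}{}_n^{fr}$ are homotopic.
   Context: $I=[-1,1]$, $e_1=(1,0,0)$, $\Delta^n=\{t=(t_1,\dots,t_n):-1\le t_1\le\dots\le t_n\le1\}$, with $t_0=-1$, $t_{n+1}=1$. $\widetilde C_n\langle\mathbb R^3\rangle$ is the closure in $(S^2)^{\binom n2}$ of the set of all $(v_{ab})_{1\le a<b\le n}$, $v_{ab}=(x_b-x_a)/|x_b-x_a|$, for $x_1,\dots,x_n$ distinct points of $\mathbb R^3$ (a point for $n\le1$), and $\widetilde C_n^{fr}\langle\mathbb R^3\rangle=\widetilde C_n\langle\mathbb R^3\rangle\times O(3)^n$, with elements $((v_{ab}),(\alpha_a))$. The coface maps $d^i:\widetilde C^{fr}_{n-1}\langle\mathbb R^3\rangle\to\widetilde C_n^{fr}\langle\mathbb R^3\rangle$, $0\le i\le n$, are: for $1\le i\le n-1$, replace the $i$-th point by two consecutive points with the same frame $\alpha_i$, the same directions to all other points, and direction $\alpha_ie_1$ from the first to the second; $d^0$ adds a new first point with frame $\mathrm{id}$ and $v_{1b}=e_1$ for all $b$; $d^n$ adds a new last point with frame $\mathrm{id}$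 and $v_{an}=e_1$ for all $a$. $\widetilde{AM}{}_n^{fr}$ is the homotopy limit over the poset of nonempty subsets $S\subseteq\{0,\dots,n\}$ of the diagram $S\mapsto\widetilde C^{fr}_{\#S-1}\langle\mathbb R^3\rangle$ formed from these cofaces; concretely it is the subspace of $\mathrm{Map}(\Delta^n,\widetilde C_n^{fr}\langle\mathbb R^3\rangle)$ of all $\phi$ with $\phi(t)\in\mathrm{im}(d^i)$ whenever $t_i=t_{i+1}$, $0\le i\le n$. For a closed interval $L\subseteq I$, let $L:I\to L$ also denote the increasing affine bijection, $L^\circ=L([-\tfrac12,\tfrac12])$, $\kappa_L:I\to I$ the map equal to $L^{-1}$ on $L$, $-1$ left of $L$ and $1$ right of $L$, and let $e_L:I\to I$ be a monotone continuous map which sends $L^\circ$ to the point $L(0)$ and is the identity outside $L$; all are applied coordinatewise to $t\in\Delta^n$. For two subintervals $L_1,L_2$ (possibly overlapping), $\phi,\psi\in\widetilde{AM}{}_n^{fr}$ and $t\in\Delta^n$, write $\phi(\kappa_{L_1^\circ}(t))=((u_{ab}),(\beta_a))$, $s=e_{L_1}(t)$, $\psi(\kappa_{L_2^\circ}(s))=((w_{ab}),(\gamma_a))$. Then $\mu_{L_1,L_2}(\phi,\psi)(t)$ has frames $\gamma_a\beta_a$ and directions $v_{ab}=\gamma_au_{ab}$ if $s_a=s_b$, $v_{ab}=w_{ab}$ if $s_a<s_b$. Put $\mu=\mu_{[-1,0],[0,1]}$. *)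

theory Defs
  imports "HOL-Analysis.Analysis"
begin

section \<open>Mapping spaces\<close>

definition Map_set :: "'a topology \<Rightarrow> 'b topology \<Rightarrow> ('a \<Rightarrow> 'b) set" where
  "Map_set X Y = {f \<in> extensional (topspace X). continuous_map X Y f}"

text \<open>The space of continuous maps with the compact-open topology.  Maps are
  extensional, so that a point of the space is determined by its values on \<open>X\<close>.\<close>

definition compact_open_topology :: "'a topology \<Rightarrow> 'b topology \<Rightarrow> ('a \<Rightarrow> 'b) topology" where
  "compact_open_topology X Y =
     topology_generated_by
       {{f \<in> Map_set X Y. f ` K \<subseteq> U} | K U. compactin X K \<and> openin Y U}"

lemma topspace_compact_open_topology [simp]:
  "topspace (compact_open_topology X Y) = Map_set X Y"
proof -
  have "Map_set X Y \<in> {{f \<in> Map_set X Y. f ` K \<subseteq> U} | K U. compactin X K \<and> openin Y U}"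
    using compactin_empty[of X] openin_empty[of Y] by blast
  then show ?thesis
    unfolding compact_open_topology_def topology_generated_by_topspace by blast
qed


section \<open>The simplex\<close>

text \<open>A point of \<open>\<Delta>\<^sup>n\<close> is an extensional function on \<open>{1..n}\<close>;
  \<open>bdry n t\<close> adds the conventions \<open>t\<^sub>0 = -1\<close>, \<open>t\<^sub>n\<^sub>+\<^sub>1 = 1\<close>.\<close>

definition bdry :: "nat \<Rightarrow> (nat \<Rightarrow> real) \<Rightarrow> nat \<Rightarrow> real" where
  "bdry n t i = (if i = 0 then -1 else if i = n + 1 then 1 else t i)"

definition Delta :: "nat \<Rightarrow> (nat \<Rightarrow> real) set" where
  "Delta n = {t \<in> extensional {1..n}. \<forall>i\<in>{0..n}. bdry n t i \<le> bdry n t (i + 1)}"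

definition Delta_top :: "nat \<Rightarrow> (nat \<Rightarrow> real) topology" where
  "Delta_top n = subtopology (product_topology (\<lambda>_. euclideanreal) {1..n}) (Delta n)"


section \<open>Framed configurations\<close>

definition e1 :: "real^3" where
  "e1 = vector [1, 0, 0]"

definition pairs :: "nat \<Rightarrow> (nat \<times> nat) set" where
  "pairs n = {(a, b). 1 \<le> a \<and> a < b \<and> b \<le> n}"

type_synonym directions = "nat \<times> nat \<Rightarrow> real^3"
type_synonym frames = "nat \<Rightarrow> real^3^3"

definition sphere_power :: "nat \<Rightarrow> directions topology" where
  "sphere_power n = product_topology (\<lambda>_. top_of_set (sphere 0 1)) (pairs n)"

definition direction_map :: "nat \<Rightarrow> (nat \<Rightarrow> real^3) \<Rightarrow> directions" where
  "direction_map n x = (\<lambda>(a, b)\<in>pairs n. (x b - x a) /\<^sub>R norm (x b - x a))"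

definition C_set :: "nat \<Rightarrow> directions set" where
  "C_set n = sphere_power n closure_of {direction_map n x | x. inj_on x {1..n}}"

definition C_top :: "nat \<Rightarrow> directions topology" where
  "C_top n = subtopology (sphere_power n) (C_set n)"

definition Cfr_top :: "nat \<Rightarrow> (directions \<times> frames) topology" where
  "Cfr_top n = prod_topology (C_top n)
     (product_topology (\<lambda>_. top_of_set {A. orthogonal_matrix A}) {1..n})"

text \<open>\<open>coface n i\<close>, for \<open>0 \<le> i \<le> n\<close>, is the coface \<open>d\<^sup>i\<close> from configurations of
  \<open>n - 1\<close> points to configurations of \<open>n\<close> points.\<close>

definition coface :: "nat \<Rightarrow> nat \<Rightarrow> directions \<times> frames \<Rightarrow> directions \<times> frames" where
  "coface n i = (\<lambda>(v, \<alpha>).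
     if i = 0 then
       (\<lambda>(a, b)\<in>pairs n. if a = 1 then e1 else v (a - 1, b - 1),
        \<lambda>a\<in>{1..n}. if a = 1 then mat 1 else \<alpha> (a - 1))
     else if i = n then
       (\<lambda>(a, b)\<in>pairs n. if b = n then e1 else v (a, b),
        \<lambda>a\<in>{1..n}. if a = n then mat 1 else \<alpha> a)
     else
       (let p = (\<lambda>a. if a \<le> i then a else a - 1) in
         (\<lambda>(a, b)\<in>pairs n. if a = i \<and> b = i + 1 then \<alpha> i *v e1 else v (p a, p b),
          \<lambda>a\<in>{1..n}. \<alpha> (p a))))"

text \<open>For \<open>n = 0\<close> there is no coface, but then the condition below is void because
  \<open>t\<^sub>0 = -1 \<noteq> 1 = t\<^sub>1\<close>.\<close>

definition AM_set :: "nat \<Rightarrow> ((nat \<Rightarrow> real) \<Rightarrow> directions \<times> frames) set" where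
  "AM_set n = {\<phi> \<in> Map_set (Delta_top n) (Cfr_top n).
     \<forall>t\<in>Delta n. \<forall>i\<in>{0..n}. bdry n t i = bdry n t (i + 1)
        \<longrightarrow> \<phi> t \<in> coface n i ` topspace (Cfr_top (n - 1))}"

definition AM_top :: "nat \<Rightarrow> ((nat \<Rightarrow> real) \<Rightarrow> directions \<times> frames) topology" where
  "AM_top n = subtopology (compact_open_topology (Delta_top n) (Cfr_top n)) (AM_set n)"


section \<open>Intervals and the product\<close>

text \<open>A closed subinterval of \<open>I = [-1, 1]\<close> is represented by its pair of endpoints.\<close>

type_synonym interval = "real \<times> real"

definition subinterval :: "interval \<Rightarrow> bool" where
  "subinterval L \<longleftrightarrow> -1 \<le> fst L \<and> fst L < snd L \<and> snd L \<le> 1"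

definition affine_bij :: "interval \<Rightarrow> real \<Rightarrow> real" where
  "affine_bij L x = (fst L + snd L) / 2 + (snd L - fst L) / 2 * x"

definition core :: "interval \<Rightarrow> interval" where
  "core L = (affine_bij L (-1/2), affine_bij L (1/2))"

definition kappa :: "interval \<Rightarrow> real \<Rightarrow> real" where
  "kappa L t = (if t < fst L then -1 else if t > snd L then 1
     else inv_into {-1..1} (affine_bij L) t)"

text \<open>The conditions on a map \<open>e\<^sub>L\<close>, which is not determined by \<open>L\<close>.\<close>

definition collapse_map :: "interval \<Rightarrow> (real \<Rightarrow> real) \<Rightarrow> bool" where
  "collapse_map L f \<longleftrightarrow>
     f \<in> {-1..1} \<rightarrow> {-1..1} \<and> mono_on {-1..1} f \<and> continuous_on {-1..1} f \<and>
     (\<forall>x\<in>{fst (core L)..snd (core L)}. f x = affine_bij L 0) \<and>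
     (\<forall>x\<in>{-1..1} - {fst L..snd L}. f x = x)"

text \<open>In \<open>mu_gen\<close> the case \<open>s a \<noteq> s b\<close> is \<open>s a < s b\<close>, since \<open>a < b\<close> and \<open>e L1\<close> is monotone.\<close>

definition mu_gen ::
  "nat \<Rightarrow> (interval \<Rightarrow> real \<Rightarrow> real) \<Rightarrow> interval \<Rightarrow> interval \<Rightarrow>
   ((nat \<Rightarrow> real) \<Rightarrow> directions \<times> frames) \<Rightarrow> ((nat \<Rightarrow> real) \<Rightarrow> directions \<times> frames) \<Rightarrow>
   ((nat \<Rightarrow> real) \<Rightarrow> directions \<times> frames)" where
  "mu_gen n e L1 L2 \<phi> \<psi> = (\<lambda>t\<in>Delta n.
     let (u, \<beta>) = \<phi> (compose {1..n} (kappa (core L1)) t);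
         s = compose {1..n} (e L1) t;
         (w, \<gamma>) = \<psi> (compose {1..n} (kappa (core L2)) s)
     in (\<lambda>(a, b)\<in>pairs n. if s a = s b then \<gamma> a *v u (a, b) else w (a, b),
         \<lambda>a\<in>{1..n}. \<gamma> a ** \<beta> a))"

definition mu ::
  "nat \<Rightarrow> (interval \<Rightarrow> real \<Rightarrow> real) \<Rightarrow>
   ((nat \<Rightarrow> real) \<Rightarrow> directions \<times> frames) \<Rightarrow> ((nat \<Rightarrow> real) \<Rightarrow> directions \<times> frames) \<Rightarrow>
   ((nat \<Rightarrow> real) \<Rightarrow> directions \<times> frames)" where
  "mu n e = mu_gen n e (-1, 0) (0, 1)"

end

theory Submission
  imports Defs
begin

text \<open>The product \<open>\<phi> \<cdot> \<psi>\<close> shrinks \<open>\<phi>\<close> to the core of the left half of the interval, shrinks \<open>\<psi>\<close> to the core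
of the right half, and inserts the configuration of \<open>\<phi>\<close>, rotated by the frames of \<open>\<psi>\<close>, as an
infinitesimal cluster into the configuration of \<open>\<psi>\<close>.  Such an insertion makes sense for any position
of the two intervals, overlapping or not, so the interval of \<open>\<phi>\<close> can be slid to the right past the
interval of \<open>\<psi>\<close>.  At the end of the slide the intervals are disjoint again, and at each coordinate at
least one of the two configurations is trivial there; so it no longer matters which of the two is
inserted into the other, and the result is \<open>\<psi> \<cdot> \<phi>\<close>.

Three observations make this precise.

\<^item> The conditions \<open>\<phi> t \<in> im d\<^sup>i\<close> for \<open>t\<^sub>i = t\<^sub>i\<^sub>+\<^sub>1\<close> together say that directions and frames
  depend only on the values of the coordinates, that points with the same coordinate are aligned along
  their common frame, and that points at \<open>\<plusminus>1\<close> are standard (\<open>compatible\<close>, \<open>AM_set_eq\<close>).  In this form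
  they are visibly preserved by insertion.

\<^item> For compatible configurations the two cases in the direction of the product are one formula,
  \<open>v\<^sub>a\<^sub>b = w\<^sub>a\<^sub>b + \<gamma>\<^sub>a (u\<^sub>a\<^sub>b - e\<^sub>1)\<close>: inside a cluster \<open>w\<^sub>a\<^sub>b = \<gamma>\<^sub>a e\<^sub>1\<close>, and between different
  clusters \<open>u\<^sub>a\<^sub>b = e\<^sub>1\<close>.  This formula (\<open>graft\<close>) is continuous, so nothing has to be glued.  That
  its value lies again in the closure defining the configuration space is the geometric content
  (\<open>C_set_substitute\<close>, \<open>graft_in_Cfr_top\<close>).

\<^item> Written like this, the product depends on the map \<open>e\<^sub>L\<close> only through the coordinates that \<open>\<psi>\<close>
  sees, and for disjoint intervals these do not depend on its choice (\<open>mu_eq_graft\<close>).  So although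
  \<open>e\<^sub>L\<close> is an arbitrary choice for each \<open>L\<close>, with no continuity in \<open>L\<close>, an explicit continuous family
  of collapsing maps can be used during the slide.

The homotopy is \<open>sliding_product n c\<close>, where \<open>c\<close>, the centre of the interval of \<open>\<phi>\<close>, runs from \<open>-1/2\<close> to
\<open>1/2\<close>.  Its continuity in the compact-open topology follows from the exponential law
(\<open>continuous_map_into_compact_open\<close>, \<open>continuous_map_evaluation\<close>), since the simplex is compact and
Hausdorff.\<close>

section \<open>The exponential law for the compact-open topology\<close>

text \<open>Currying preserves continuity.  A compact set on which \<open>g z\<close> has values in an open set has this
property for all nearby \<open>z\<close> as well, by the tube lemma.\<close>

lemma continuous_map_into_compact_open:
  assumes g: "continuous_map (prod_topology Z X) Y (\<lambda>(z, x). g z x)"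
    and ext: "\<And>z. z \<in> topspace Z \<Longrightarrow> g z \<in> extensional (topspace X)"
  shows "continuous_map Z (compact_open_topology X Y) g"
proof -
  have Map: "g z \<in> Map_set X Y" if "z \<in> topspace Z" for z
    using continuous_map_o_Pair[OF g that] ext[OF that] by (simp add: Map_set_def o_def)
  have op: "openin Z {z \<in> topspace Z. g z ` K \<subseteq> U}" if K: "compactin X K" and U: "openin Y U" for K U
  proof (subst openin_subopen, safe)
    fix z assume z: "z \<in> topspace Z" "g z ` K \<subseteq> U"
    define W where "W = {p \<in> topspace (prod_topology Z X). (\<lambda>(z, x). g z x) p \<in> U}"
    have "openin (prod_topology Z X) W"
      unfolding W_def by (rule openin_continuous_map_preimage[OF g U])
    moreover have "{z} \<times> K \<subseteq> W"
      using z compactin_subset_topspace[OF K] by (auto simp: W_def)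
    ultimately have "\<exists>A B. openin Z A \<and> openin X B \<and> z \<in> A \<and> K \<subseteq> B \<and> A \<times> B \<subseteq> W"
      by (rule tube_lemma_right[OF _ K z(1)])
    then obtain A B where AB: "openin Z A" "z \<in> A" "K \<subseteq> B" "A \<times> B \<subseteq> W"
      by (elim exE conjE)
    show "\<exists>T. openin Z T \<and> z \<in> T \<and> T \<subseteq> {z \<in> topspace Z. g z ` K \<subseteq> U}"
    proof (intro exI conjI)
      show "A \<subseteq> {z \<in> topspace Z. g z ` K \<subseteq> U}"
      proof safe
        fix y x assume "y \<in> A" "x \<in> K"
        then have "(y, x) \<in> W"
          using AB(3,4) by blast
        then show "g y x \<in> U"
          by (simp add: W_def)
      qed (use openin_subset[OF AB(1)] in blast)
    qed (use AB in auto)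
  qed
  show ?thesis
    unfolding compact_open_topology_def
  proof (rule continuous_on_generated_topo)
    fix U assume "U \<in> {{f \<in> Map_set X Y. f ` K \<subseteq> U} | K U. compactin X K \<and> openin Y U}"
    then obtain K V where KV: "compactin X K" "openin Y V" "U = {f \<in> Map_set X Y. f ` K \<subseteq> V}"
      by blast
    have "g -` U \<inter> topspace Z = {z \<in> topspace Z. g z ` K \<subseteq> V}"
      using Map KV(3) by auto
    then show "openin Z (g -` U \<inter> topspace Z)"
      using op[OF KV(1,2)] by simp
  next
    have "Map_set X Y \<subseteq> \<Union> {{f \<in> Map_set X Y. f ` K \<subseteq> U} | K U. compactin X K \<and> openin Y U}"
      using topspace_compact_open_topology[of X Y]
      unfolding compact_open_topology_def topology_generated_by_topspace by simp
    then show "g ` topspace Z \<subseteq> \<Union> {{f \<in> Map_set X Y. f ` K \<subseteq> U} | K U. compactin X K \<and> openin Y U}"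
      using Map by blast
  qed
qed

text \<open>Continuity of evaluation needs local compactness: near \<open>(f, x)\<close>, the values are controlled on a whole
compact neighbourhood of \<open>x\<close>, which is what a subbasic open set of maps can express.\<close>

lemma continuous_map_evaluation:
  assumes X: "neighbourhood_base_of (compactin X) X"
  shows "continuous_map (prod_topology (compact_open_topology X Y) X) Y (\<lambda>(f, x). f x)"
  unfolding continuous_map
proof (intro conjI allI impI)
  show "(\<lambda>(f, x). f x) ` topspace (prod_topology (compact_open_topology X Y) X) \<subseteq> topspace Y"
    by (auto simp: Map_set_def continuous_map_def)
next
  fix U assume U: "openin Y U"
  let ?E = "{p \<in> topspace (prod_topology (compact_open_topology X Y) X). (case p of (f, x) \<Rightarrow> f x) \<in> U}"
  show "openin (prod_topology (compact_open_topology X Y) X) ?E"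
  proof (subst openin_subopen, safe)
    fix f x
    assume "(f, x) \<in> topspace (prod_topology (compact_open_topology X Y) X)" and fx: "f x \<in> U"
    then have f: "f \<in> Map_set X Y" and x: "x \<in> topspace X"
      by auto
    have cont: "continuous_map X Y f"
      using f by (simp add: Map_set_def)
    have "openin X {x \<in> topspace X. f x \<in> U}"
      by (rule openin_continuous_map_preimage[OF cont U])
    then obtain V K where VK: "openin X V" "compactin X K" "x \<in> V" "V \<subseteq> K" "K \<subseteq> {x \<in> topspace X. f x \<in> U}"
      using X x fx unfolding neighbourhood_base_of by (metis (mono_tags, lifting) mem_Collect_eq)
    let ?N = "{f \<in> Map_set X Y. f ` K \<subseteq> U}"
    have "openin (compact_open_topology X Y) ?N"
      unfolding compact_open_topology_def
      by (rule topology_generated_by_Basis) (use VK U in blast)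
    then have "openin (prod_topology (compact_open_topology X Y) X) (?N \<times> V)"
      using VK by (simp add: openin_prod_Times_iff)
    moreover have "(f, x) \<in> ?N \<times> V"
      using f VK by auto
    moreover have "?N \<times> V \<subseteq> ?E"
      using VK by auto
    ultimately show "\<exists>T. openin (prod_topology (compact_open_topology X Y) X) T \<and> (f, x) \<in> T \<and> T \<subseteq> ?E"
      by blast
  qed
qed

section \<open>The simplex\<close>

lemma bdry_0 [simp]: "bdry n t 0 = -1"
  by (simp add: bdry_def)

lemma bdry_last [simp]: "bdry n t (Suc n) = 1"
  by (simp add: bdry_def)

lemma bdry_mid: "a \<in> {1..n} \<Longrightarrow> bdry n t a = t a"
  by (simp add: bdry_def)

lemma Delta_mono:
  assumes "t \<in> Delta n" "i \<le> j" "j \<le> Suc n"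
  shows "bdry n t i \<le> bdry n t j"
  using assms(2,3)
proof (induction j rule: dec_induct)
  case (step j)
  then have "bdry n t j \<le> bdry n t (j + 1)"
    using assms(1) by (simp add: Delta_def)
  then show ?case using step by simp
qed simp

lemma Delta_le: "t \<in> Delta n \<Longrightarrow> 1 \<le> a \<Longrightarrow> a \<le> b \<Longrightarrow> b \<le> n \<Longrightarrow> t a \<le> t b"
  using Delta_mono[of t n a b] by (simp add: bdry_def)

lemma Delta_range:
  assumes "t \<in> Delta n" "a \<in> {1..n}"
  shows "t a \<in> {-1..1}"
  using Delta_mono[OF assms(1), of 0 a] Delta_mono[OF assms(1), of a "Suc n"] assms(2) bdry_mid[OF assms(2)]
  by auto

lemma compose_in_Delta:
  assumes t: "t \<in> Delta n" and k: "mono_on {-1..1} k" "k \<in> {-1..1} \<rightarrow> {-1..1}"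
  shows "compose {1..n} k t \<in> Delta n"
proof -
  have "bdry n (compose {1..n} k t) i \<le> bdry n (compose {1..n} k t) (i + 1)" if "i \<le> n" for i
  proof (cases "i = 0 \<or> i = n")
    case True
    then show ?thesis
      using Delta_range[OF t] k(2) that by (auto simp: bdry_def compose_def Pi_iff)
  next
    case False
    with that have i: "i \<in> {1..n}" "i + 1 \<in> {1..n}" by auto
    then show ?thesis
      using Delta_range[OF t] Delta_le[OF t, of i "i + 1"] mono_onD[OF k(1), of "t i" "t (i + 1)"]
      by (simp add: bdry_def compose_def)
  qed
  then show ?thesis
    by (simp add: Delta_def compose_def)
qed

lemma topspace_Delta_top [simp]: "topspace (Delta_top n) = Delta n"
  by (auto simp: Delta_top_def Delta_def PiE_def)

lemma continuous_map_Delta_coordinate: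
  "a \<in> {1..n} \<Longrightarrow> continuous_map (Delta_top n) euclideanreal (\<lambda>t. t a)"
  unfolding Delta_top_def
  by (intro continuous_map_from_subtopology continuous_map_product_projection)

lemma continuous_map_into_Delta:
  assumes "\<And>x. x \<in> topspace X \<Longrightarrow> f x \<in> Delta n"
    and "\<And>a. a \<in> {1..n} \<Longrightarrow> continuous_map X euclideanreal (\<lambda>x. f x a)"
  shows "continuous_map X (Delta_top n) f"
  unfolding Delta_top_def continuous_map_in_subtopology continuous_map_componentwise
  using assms by (auto simp: Delta_def)

text \<open>The simplex is a closed subset of the cube \<open>[-1, 1]\<^sup>n\<close>.\<close>

lemma compact_space_Delta_top:
  "compact_space (Delta_top n)"
proof -
  let ?P = "product_topology (\<lambda>_. euclideanreal) {1..n}"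
  have "continuous_map ?P euclideanreal (\<lambda>t. bdry n t i)" if "i \<le> n + 1" for i
    using that by (cases "i = 0 \<or> i = n + 1")
      (auto simp: bdry_def intro: continuous_map_product_projection)
  then have "continuous_map ?P euclideanreal (\<lambda>t. bdry n t (i + 1) - bdry n t i)" if "i \<le> n" for i
    using that by (intro continuous_map_diff) simp_all
  then have cl: "closedin ?P {t \<in> topspace ?P. bdry n t (i + 1) - bdry n t i \<in> {0..}}" if "i \<le> n" for i
    using that by (intro closedin_continuous_map_preimage[where Y = euclideanreal]) simp_all
  have eq: "Delta n = (\<Inter>i\<in>{0..n}. {t \<in> topspace ?P. bdry n t (i + 1) - bdry n t i \<in> {0..}})"
    by (auto simp: Delta_def PiE_def extensional_def)
  have "closedin ?P (Delta n)"
    unfolding eq using cl by (intro closedin_INT) auto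
  moreover have "compactin ?P (PiE {1..n} (\<lambda>_. {-1..1}))"
    by (simp add: compactin_PiE)
  moreover have "Delta n \<subseteq> PiE {1..n} (\<lambda>_. {-1..1})"
    using Delta_range by (auto simp: Delta_def PiE_def)
  ultimately have "compactin ?P (Delta n)"
    by (meson closed_compactin)
  then show ?thesis
    by (simp add: Delta_top_def compact_space_subtopology)
qed

lemma Hausdorff_space_Delta_top: "Hausdorff_space (Delta_top n)"
  unfolding Delta_top_def
  by (rule Hausdorff_space_subtopology) (metis Hausdorff_space_euclidean Hausdorff_space_product_topology)

lemma Delta_neighbourhood_base: "neighbourhood_base_of (compactin (Delta_top n)) (Delta_top n)"
proof -
  have "locally_compact_space (Delta_top n)"
    by (rule compact_imp_locally_compact_space[OF compact_space_Delta_top])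
  then show ?thesis
    using locally_compact_space_neighbourhood_base[of "Delta_top n"] Hausdorff_space_Delta_top by metis
qed

section \<open>Spaces of configurations\<close>

lemma topspace_sphere_power: "topspace (sphere_power n) = PiE (pairs n) (\<lambda>_. sphere 0 1)"
  by (simp add: sphere_power_def)

lemma C_set_subset: "C_set n \<subseteq> PiE (pairs n) (\<lambda>_. sphere 0 1)"
  unfolding C_set_def topspace_sphere_power[symmetric] by (rule closure_of_subset_topspace)

lemma topspace_Cfr_top:
  "topspace (Cfr_top n) = C_set n \<times> PiE {1..n} (\<lambda>_. {A. orthogonal_matrix A})"
  using C_set_subset by (auto simp: Cfr_top_def C_top_def topspace_sphere_power)

lemma direction_map_in_C_set:
  assumes "inj_on x {1..n}"
  shows "direction_map n x \<in> C_set n"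
proof -
  have "direction_map n x \<in> topspace (sphere_power n)"
    unfolding topspace_sphere_power direction_map_def
  proof (intro restrict_PiE_iff[THEN iffD2] ballI)
    fix p assume "p \<in> pairs n"
    then obtain a b where p: "p = (a, b)" "a \<in> {1..n}" "b \<in> {1..n}" "a \<noteq> b"
      by (auto simp: pairs_def)
    then have "x b - x a \<noteq> 0"
      using inj_onD[OF assms, of a b] by auto
    then show "(case p of (a, b) \<Rightarrow> (x b - x a) /\<^sub>R norm (x b - x a)) \<in> sphere 0 1"
      using p by simp
  qed
  then show ?thesis
    unfolding C_set_def using assms
    by (intro subsetD[OF closure_of_subset_Int]) blast
qed

lemma norm_orthogonal_matrix: "orthogonal_matrix A \<Longrightarrow> norm (A *v x) = norm (x::real^'n)"
  by (metis orthogonal_transformation_norm orthogonal_transformation_matrix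
    matrix_of_matrix_vector_mul matrix_vector_mul_linear)

lemma continuous_map_into_sphere_power:
  assumes "\<And>x. x \<in> topspace X \<Longrightarrow> f x \<in> PiE (pairs n) (\<lambda>_. sphere 0 1)"
    and "\<And>a b. (a, b) \<in> pairs n \<Longrightarrow> continuous_map X euclidean (\<lambda>x. f x (a, b))"
  shows "continuous_map X (sphere_power n) f"
  unfolding sphere_power_def continuous_map_componentwise
proof (intro conjI ballI)
  show "f ` topspace X \<subseteq> extensional (pairs n)"
    using assms(1) by (auto simp: PiE_def)
  fix p assume p: "p \<in> pairs n"
  then have "continuous_map X euclidean (\<lambda>x. f x p)"
    using assms(2) by (cases p) auto
  then show "continuous_map X (top_of_set (sphere 0 1)) (\<lambda>x. f x p)"
    unfolding continuous_map_in_subtopology using assms(1) p by (auto simp: PiE_def Pi_iff)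
qed

lemma continuous_map_sphere_power_coordinate:
  assumes "p \<in> pairs n"
  shows "continuous_map (sphere_power n) euclidean (\<lambda>v. v p)"
proof -
  have "continuous_map (sphere_power n) (top_of_set (sphere 0 1)) (\<lambda>v. v p)"
    unfolding sphere_power_def using assms by (rule continuous_map_product_projection)
  then show ?thesis
    by (rule continuous_map_into_fulltopology)
qed

text \<open>Forgetting points of a configuration is continuous in the directions and is defined on honest
configurations, hence also on their closure.\<close>

lemma C_set_reindex:
  assumes u: "u \<in> C_set n" and f: "f \<in> {1..m} \<rightarrow> {1..n}" "strict_mono_on {1..m} f"
  shows "(\<lambda>(a, b)\<in>pairs m. u (f a, f b)) \<in> C_set m"
proof -
  let ?F = "\<lambda>u. \<lambda>(a, b)\<in>pairs m. u (f a, f b)"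
  have pairs: "(f a, f b) \<in> pairs n" if "(a, b) \<in> pairs m" for a b
    using f(1) strict_mono_onD[OF f(2), of a b] that by (auto simp: pairs_def Pi_iff)
  have "continuous_map (sphere_power n) (sphere_power m) ?F"
  proof (rule continuous_map_into_sphere_power)
    show "?F u \<in> PiE (pairs m) (\<lambda>_. sphere 0 1)" if "u \<in> topspace (sphere_power n)" for u
      using that pairs by (fastforce simp: topspace_sphere_power)
    show "continuous_map (sphere_power n) euclidean (\<lambda>u. ?F u (a, b))" if "(a, b) \<in> pairs m" for a b
      using that continuous_map_sphere_power_coordinate[OF pairs[OF that]] by simp
  qed
  then have "?F ` C_set n \<subseteq> sphere_power m closure_of ?F ` {direction_map n x | x. inj_on x {1..n}}"
    unfolding C_set_def by (rule continuous_map_image_closure_subset)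
  moreover have "?F ` {direction_map n x | x. inj_on x {1..n}} \<subseteq> {direction_map m x | x. inj_on x {1..m}}"
  proof clarify
    fix x :: "nat \<Rightarrow> real^3" assume x: "inj_on x {1..n}"
    have "inj_on (x \<circ> f) {1..m}"
      using strict_mono_on_imp_inj_on[OF f(2)] f(1) x
      by (intro comp_inj_on) (auto intro: inj_on_subset)
    moreover have "?F (direction_map n x) = direction_map m (x \<circ> f)"
      using pairs by (auto simp: direction_map_def restrict_def fun_eq_iff)
    ultimately show "\<exists>x'. ?F (direction_map n x) = direction_map m x' \<and> inj_on x' {1..m}"
      by blast
  qed
  ultimately have "?F ` C_set n \<subseteq> C_set m"
    unfolding C_set_def using closure_of_mono by (meson subset_trans)
  then show ?thesis
    using u by blast
qed

text \<open>Operadic insertion: the points of each fibre of \<open>r\<close> form an infinitesimal cluster.  If \<open>u\<close> and \<open>w\<close> are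
the directions of honest configurations \<open>x\<close> and \<open>y\<close>, then the new directions are limits, for
\<open>\<epsilon> \<rightarrow> 0\<close>, of those of the points \<open>y (r a) + \<epsilon> \<gamma> (r a) x a\<close>.  The general case follows
because the new directions depend continuously on \<open>u\<close> and \<open>w\<close>.\<close>

lemma C_set_substitute:
  assumes u: "u \<in> C_set n" and w: "w \<in> C_set n"
    and \<gamma>: "\<And>a. a \<in> {1..n} \<Longrightarrow> orthogonal_matrix (\<gamma> a)"
    and r: "r \<in> {1..n} \<rightarrow> {1..n}" "mono_on {1..n} r"
  shows "(\<lambda>(a, b)\<in>pairs n. if r a = r b then \<gamma> (r a) *v u (a, b) else w (r a, r b)) \<in> C_set n"
proof -
  let ?F = "\<lambda>(u, w). \<lambda>(a, b)\<in>pairs n. if r a = r b then \<gamma> (r a) *v u (a, b) else w (r a, r b)"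
  let ?P = "prod_topology (sphere_power n) (sphere_power n)"
  let ?D = "{direction_map n x | x. inj_on x {1..n}}"
  have pairs: "(r a, r b) \<in> pairs n" if "(a, b) \<in> pairs n" "r a \<noteq> r b" for a b
    using r(1) mono_onD[OF r(2), of a b] that by (auto simp: pairs_def Pi_iff)
  have orth: "orthogonal_matrix (\<gamma> (r a))" if "a \<in> {1..n}" for a
    using \<gamma> r(1) that by (auto simp: Pi_iff)
  have F_sphere: "?F (u, w) \<in> PiE (pairs n) (\<lambda>_. sphere 0 1)"
    if "u \<in> topspace (sphere_power n)" "w \<in> topspace (sphere_power n)" for u w
  proof (rule PiE_I)
    fix p assume "p \<in> pairs n"
    then obtain a b where p: "p = (a, b)" "(a, b) \<in> pairs n"
      by (cases p) auto
    have "norm (u (a, b)) = 1"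
      using p that(1) by (auto simp: topspace_sphere_power)
    moreover have "norm (w (r a, r b)) = 1" if "r a \<noteq> r b"
      using pairs[OF p(2) that] \<open>w \<in> _\<close> by (auto simp: topspace_sphere_power)
    ultimately show "?F (u, w) p \<in> sphere 0 1"
      using p norm_orthogonal_matrix[OF orth[of a]] by (auto simp: pairs_def)
  qed auto
  have "continuous_map ?P (sphere_power n) ?F"
  proof (rule continuous_map_into_sphere_power)
    show "?F q \<in> PiE (pairs n) (\<lambda>_. sphere 0 1)" if "q \<in> topspace ?P" for q
    proof -
      obtain u w where "q = (u, w)" "u \<in> topspace (sphere_power n)" "w \<in> topspace (sphere_power n)"
        using \<open>q \<in> topspace ?P\<close> by auto
      then show ?thesis
        using F_sphere[of u w] by (simp only:)
    qed
    fix a b assume ab: "(a, b) \<in> pairs n"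
    have u: "continuous_map ?P euclidean (\<lambda>q. \<gamma> (r a) *v fst q (a, b))"
      using continuous_map_compose[OF continuous_map_compose[OF continuous_map_fst
            continuous_map_sphere_power_coordinate[OF ab]], of euclidean "(*v) (\<gamma> (r a))"]
      by (simp add: o_def continuous_on_eq_continuous_at matrix_vector_mult_linear_continuous_at)
    have w: "continuous_map ?P euclidean (\<lambda>q. snd q (r a, r b))" if "r a \<noteq> r b"
      using continuous_map_compose[OF continuous_map_snd
            continuous_map_sphere_power_coordinate[OF pairs[OF ab that]]]
      by (simp add: o_def)
    show "continuous_map ?P euclidean (\<lambda>q. ?F q (a, b))"
      using u w ab by (cases "r a = r b") (simp_all add: case_prod_unfold)
  qed
  then have "?F ` (?P closure_of (?D \<times> ?D)) \<subseteq> sphere_power n closure_of ?F ` (?D \<times> ?D)"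
    by (rule continuous_map_image_closure_subset)
  moreover have "?F ` (?D \<times> ?D) \<subseteq> C_set n"
  proof (rule image_subsetI)
    fix q assume "q \<in> ?D \<times> ?D"
    then obtain x y where x: "inj_on x {1..n}" and y: "inj_on y {1..n}"
      and q: "q = (direction_map n x, direction_map n y)"
      by blast
    let ?f = "?F (direction_map n x, direction_map n y)"
    define z where "z = (\<lambda>\<epsilon> a. y (r a) + \<epsilon> *\<^sub>R (\<gamma> (r a) *v x a))" for \<epsilon>
    have same: "z \<epsilon> b - z \<epsilon> a = \<epsilon> *\<^sub>R (\<gamma> (r a) *v (x b - x a))" if "r a = r b" for \<epsilon> a b
      using that by (simp add: z_def matrix_vector_mult_diff_distrib scaleR_diff_right)
    have lim: "((\<lambda>\<epsilon>. z \<epsilon> b - z \<epsilon> a) \<longlongrightarrow> y (r b) - y (r a)) (at_right 0)" for a b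
      unfolding z_def by (rule tendsto_eq_intros | simp)+
    have ne: "\<forall>\<^sub>F \<epsilon> in at_right 0. z \<epsilon> a \<noteq> z \<epsilon> b" if ab: "a \<in> {1..n}" "b \<in> {1..n}" "a \<noteq> b" for a b
    proof (cases "r a = r b")
      case True
      have "norm (\<gamma> (r a) *v (x b - x a)) \<noteq> 0"
        using inj_onD[OF x _ ab(1,2)] ab norm_orthogonal_matrix[OF orth[OF ab(1)]] by auto
      then have "z \<epsilon> b - z \<epsilon> a \<noteq> 0" if "\<epsilon> > 0" for \<epsilon>
        using that unfolding same[OF True] by simp
      then show ?thesis
        unfolding eventually_at_filter by (intro always_eventually) force
    next
      case False
      then have "y (r b) - y (r a) \<noteq> 0"
        using inj_onD[OF y, of "r a" "r b"] r(1) ab by (auto simp: Pi_iff)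
      from tendsto_imp_eventually_ne[OF lim this] show ?thesis
        by eventually_elim auto
    qed
    have inj: "\<forall>\<^sub>F \<epsilon> in at_right 0. inj_on (z \<epsilon>) {1..n}"
    proof -
      have "\<forall>\<^sub>F \<epsilon> in at_right 0. \<forall>a\<in>{1..n}. \<forall>b\<in>{1..n}. a \<noteq> b \<longrightarrow> z \<epsilon> a \<noteq> z \<epsilon> b"
      proof (intro eventually_ball_finite ballI)
        fix a b assume "a \<in> {1..n}" "b \<in> {1..n}"
        then show "\<forall>\<^sub>F \<epsilon> in at_right 0. a \<noteq> b \<longrightarrow> z \<epsilon> a \<noteq> z \<epsilon> b"
          using ne[of a b] by (cases "a = b") auto
      qed simp_all
      then show ?thesis
        by eventually_elim (auto simp: inj_on_def)
    qed
    have "limitin (sphere_power n) (\<lambda>\<epsilon>. direction_map n (z \<epsilon>)) ?f (at_right 0)"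
      unfolding sphere_power_def limitin_componentwise
    proof (intro conjI ballI)
      show "?f \<in> extensional (pairs n)"
        by simp
      show "\<forall>\<^sub>F \<epsilon> in at_right 0. direction_map n (z \<epsilon>) \<in> topspace (product_topology (\<lambda>_. top_of_set (sphere 0 1)) (pairs n))"
        using inj unfolding sphere_power_def[symmetric] topspace_sphere_power
        by eventually_elim (use direction_map_in_C_set C_set_subset in blast)
      fix p assume "p \<in> pairs n"
      then obtain a b where p: "p = (a, b)" "(a, b) \<in> pairs n"
        by (cases p) auto
      then have ab: "a \<in> {1..n}" "b \<in> {1..n}" "a \<noteq> b"
        by (auto simp: pairs_def)
      have sphere: "?f p \<in> sphere 0 1"
        using F_sphere direction_map_in_C_set[OF x] direction_map_in_C_set[OF y] C_set_subset p
        unfolding topspace_sphere_power by blast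
      have "((\<lambda>\<epsilon>. (z \<epsilon> b - z \<epsilon> a) /\<^sub>R norm (z \<epsilon> b - z \<epsilon> a)) \<longlongrightarrow> ?f p) (at_right 0)"
      proof (cases "r a = r b")
        case True
        have "(z \<epsilon> b - z \<epsilon> a) /\<^sub>R norm (z \<epsilon> b - z \<epsilon> a) = ?f p" if "\<epsilon> > 0" for \<epsilon>
          using that True p unfolding same[OF True]
          by (simp add: norm_orthogonal_matrix[OF orth[OF ab(2)]] direction_map_def
              matrix_vector_mult_scaleR)
        then show ?thesis
          by (intro tendsto_eventually) (auto simp: eventually_at_filter)
      next
        case False
        then have "y (r b) - y (r a) \<noteq> 0"
          using inj_onD[OF y, of "r a" "r b"] r(1) ab by (auto simp: Pi_iff)
        then have "((\<lambda>\<epsilon>. (z \<epsilon> b - z \<epsilon> a) /\<^sub>R norm (z \<epsilon> b - z \<epsilon> a)) \<longlongrightarrow>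
            (y (r b) - y (r a)) /\<^sub>R norm (y (r b) - y (r a))) (at_right 0)"
          by (intro tendsto_intros lim) simp
        then show ?thesis
          using False p pairs[OF p(2) False] by (simp add: direction_map_def)
      qed
      then show "limitin (top_of_set (sphere 0 1)) (\<lambda>\<epsilon>. direction_map n (z \<epsilon>) p) (?f p) (at_right 0)"
        using sphere ne[OF ab] p unfolding limitin_subtopology
        by (auto simp: direction_map_def elim!: eventually_mono)
    qed
    then show "?F q \<in> C_set n"
      unfolding q
    proof (rule limitin_closedin)
      show "closedin (sphere_power n) (C_set n)"
        by (simp add: C_set_def)
      show "\<forall>\<^sub>F \<epsilon> in at_right 0. direction_map n (z \<epsilon>) \<in> C_set n"
        using inj by eventually_elim (rule direction_map_in_C_set)
    qed simp
  qed
  ultimately have "?F ` (?P closure_of (?D \<times> ?D)) \<subseteq> C_set n"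
    using closure_of_minimal[of "?F ` (?D \<times> ?D)" "C_set n" "sphere_power n"]
    by (auto simp: C_set_def)
  then have "?F ` (C_set n \<times> C_set n) \<subseteq> C_set n"
    unfolding closure_of_Times C_set_def .
  then show ?thesis
    using u w by auto
qed

section \<open>The boundary conditions\<close>

text \<open>The equations that cut out the image of the \<open>i\<close>-th coface: for \<open>i = 0\<close> and \<open>i = n\<close> the added point is
standard, and otherwise the points \<open>i\<close> and \<open>i + 1\<close> are a doubled point.\<close>

definition coface_equations :: "nat \<Rightarrow> nat \<Rightarrow> directions \<times> frames \<Rightarrow> bool" where
  "coface_equations n i = (\<lambda>(v, \<alpha>).
     if i = 0 then \<alpha> 1 = mat 1 \<and> (\<forall>b\<in>{2..n}. v (1, b) = e1)
     else if i = n then \<alpha> n = mat 1 \<and> (\<forall>a\<in>{1..<n}. v (a, n) = e1)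
     else \<alpha> (i + 1) = \<alpha> i \<and> v (i, i + 1) = \<alpha> i *v e1
       \<and> (\<forall>b\<in>{i + 2..n}. v (i, b) = v (i + 1, b)) \<and> (\<forall>a\<in>{1..<i}. v (a, i) = v (a, i + 1)))"

lemma coface_equations_coface:
  assumes "1 \<le> n" "i \<le> n"
  shows "coface_equations n i (coface n i c)"
  using assms by (cases c) (auto simp: coface_equations_def coface_def pairs_def Let_def)

text \<open>The \<open>i\<close>-th coface restores the point that deletion of the \<open>(i + 1)\<close>-st point (of the last point, if
\<open>i = n\<close>) has removed.  The map \<open>f\<close> enumerates the remaining points; its formula also covers \<open>i = n\<close>,
where it is the identity on the indices in use.\<close>

lemma coface_of_deletion:
  assumes n: "1 \<le> n" "i \<le> n" and c: "(v, \<alpha>) \<in> topspace (Cfr_top n)"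
    and eq: "coface_equations n i (v, \<alpha>)"
  defines "f \<equiv> \<lambda>a. if a \<le> i then a else a + 1"
  shows "coface n i (\<lambda>(a, b)\<in>pairs (n - 1). v (f a, f b), \<lambda>a\<in>{1..n - 1}. \<alpha> (f a)) = (v, \<alpha>)"
proof -
  have ext: "v \<in> extensional (pairs n)" "\<alpha> \<in> extensional {1..n}"
    using c C_set_subset[of n] by (auto simp: topspace_Cfr_top PiE_def)
  let ?c = "(\<lambda>(a, b)\<in>pairs (n - 1). v (f a, f b), \<lambda>a\<in>{1..n - 1}. \<alpha> (f a))"
  consider "i = 0" | "i \<noteq> 0" "i = n" | "i \<noteq> 0" "i < n"
    using n by linarith
  then have "fst (coface n i ?c) (a, b) = v (a, b)" if ab: "(a, b) \<in> pairs n" for a b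
  proof cases
    case 1
    then show ?thesis
      using ab eq by (cases "a = 1") (auto simp: coface_def pairs_def coface_equations_def f_def)
  next
    case 2
    then show ?thesis
      using ab eq by (cases "b = n") (auto simp: coface_def pairs_def coface_equations_def f_def)
  next
    case 3
    then have "\<alpha> (i + 1) = \<alpha> i" "v (i, i + 1) = \<alpha> i *v e1" "\<And>b. b \<in> {i + 2..n} \<Longrightarrow> v (i, b) = v (i + 1, b)"
      "\<And>a. a \<in> {1..<i} \<Longrightarrow> v (a, i) = v (a, i + 1)"
      using eq by (auto simp: coface_equations_def)
    then show ?thesis
      using 3 ab by (cases "a = i + 1"; cases "b = i + 1")
        (auto simp: coface_def pairs_def f_def Let_def)
  qed
  moreover have "snd (coface n i ?c) a = \<alpha> a" if a: "a \<in> {1..n}" for a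
  proof -
    consider "i = 0" | "i \<noteq> 0" "i = n" | "i \<noteq> 0" "i < n"
      using n by linarith
    then show ?thesis
    proof cases
      case 1
      then show ?thesis
        using a eq by (cases "a = 1") (auto simp: coface_def coface_equations_def f_def)
    next
      case 2
      then show ?thesis
        using a eq by (cases "a = n") (auto simp: coface_def coface_equations_def f_def)
    next
      case 3
      then show ?thesis
        using a eq by (cases "a = i + 1") (auto simp: coface_def coface_equations_def f_def Let_def)
    qed
  qed
  moreover have "fst (coface n i ?c) \<in> extensional (pairs n)" "snd (coface n i ?c) \<in> extensional {1..n}"
    by (auto simp: coface_def Let_def)
  ultimately show ?thesis
    using ext by (intro prod_eqI) (auto intro!: extensionalityI)
qed

lemma in_coface_image_iff:
  assumes n: "1 \<le> n" "i \<le> n" and c: "c \<in> topspace (Cfr_top n)"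
  shows "c \<in> coface n i ` topspace (Cfr_top (n - 1)) \<longleftrightarrow> coface_equations n i c"
proof
  assume eq: "coface_equations n i c"
  obtain v \<alpha> where va: "c = (v, \<alpha>)"
    by (cases c)
  let ?f = "\<lambda>a. if a \<le> i then a else a + 1"
  let ?d = "(\<lambda>(a, b)\<in>pairs (n - 1). v (?f a, ?f b), \<lambda>a\<in>{1..n - 1}. \<alpha> (?f a))"
  have "?f \<in> {1..n - 1} \<rightarrow> {1..n}" "strict_mono_on {1..n - 1} ?f"
    using n by (auto simp: strict_mono_on_def)
  then have "?d \<in> topspace (Cfr_top (n - 1))"
    using c C_set_reindex[of v n ?f "n - 1"] unfolding va topspace_Cfr_top by (auto simp: PiE_def Pi_iff)
  moreover have "c = coface n i ?d"
    using coface_of_deletion[OF n c[unfolded va] eq[unfolded va]] unfolding va by (rule sym)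
  ultimately show "c \<in> coface n i ` topspace (Cfr_top (n - 1))"
    by (rule rev_image_eqI)
qed (use coface_equations_coface n in auto)

text \<open>All the boundary conditions at \<open>t\<close> in one statement about equal coordinates, instead of one condition
for each pair of neighbours.\<close>

definition compatible :: "nat \<Rightarrow> (nat \<Rightarrow> real) \<Rightarrow> directions \<times> frames \<Rightarrow> bool" where
  "compatible n t = (\<lambda>(v, \<alpha>).
     (\<forall>a\<in>{1..n}. t a = -1 \<or> t a = 1 \<longrightarrow> \<alpha> a = mat 1) \<and>
     (\<forall>a\<in>{1..n}. \<forall>b\<in>{1..n}. t a = t b \<longrightarrow> \<alpha> a = \<alpha> b) \<and>
     (\<forall>(a, b)\<in>pairs n. t a = t b \<longrightarrow> v (a, b) = \<alpha> a *v e1) \<and>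
     (\<forall>(a, b)\<in>pairs n. t a = -1 \<or> t b = 1 \<longrightarrow> v (a, b) = e1) \<and>
     (\<forall>(a, b)\<in>pairs n. \<forall>(a', b')\<in>pairs n. t a = t a' \<and> t b = t b' \<longrightarrow> v (a, b) = v (a', b')))"

lemma compatibleD:
  assumes "compatible n t (v, \<alpha>)"
  shows "a \<in> {1..n} \<Longrightarrow> t a = -1 \<or> t a = 1 \<Longrightarrow> \<alpha> a = mat 1"
    and "a \<in> {1..n} \<Longrightarrow> b \<in> {1..n} \<Longrightarrow> t a = t b \<Longrightarrow> \<alpha> a = \<alpha> b"
    and "(a, b) \<in> pairs n \<Longrightarrow> t a = t b \<Longrightarrow> v (a, b) = \<alpha> a *v e1"
    and "(a, b) \<in> pairs n \<Longrightarrow> t a = -1 \<or> t b = 1 \<Longrightarrow> v (a, b) = e1"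
    and "(a, b) \<in> pairs n \<Longrightarrow> (a', b') \<in> pairs n \<Longrightarrow> t a = t a' \<Longrightarrow> t b = t b' \<Longrightarrow> v (a, b) = v (a', b')"
  using assms unfolding compatible_def by blast+

lemma compatibleI:
  assumes "\<And>a. a \<in> {1..n} \<Longrightarrow> t a = -1 \<or> t a = 1 \<Longrightarrow> \<alpha> a = mat 1"
    and "\<And>a b. a \<in> {1..n} \<Longrightarrow> b \<in> {1..n} \<Longrightarrow> t a = t b \<Longrightarrow> \<alpha> a = \<alpha> b"
    and "\<And>a b. (a, b) \<in> pairs n \<Longrightarrow> t a = t b \<Longrightarrow> v (a, b) = \<alpha> a *v e1"
    and "\<And>a b. (a, b) \<in> pairs n \<Longrightarrow> t a = -1 \<or> t b = 1 \<Longrightarrow> v (a, b) = e1"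
    and "\<And>a b a' b'. (a, b) \<in> pairs n \<Longrightarrow> (a', b') \<in> pairs n \<Longrightarrow> t a = t a' \<Longrightarrow> t b = t b'
      \<Longrightarrow> v (a, b) = v (a', b')"
  shows "compatible n t (v, \<alpha>)"
  using assms unfolding compatible_def by blast

lemma compatible_imp_coface_equations:
  assumes "compatible n t c" "1 \<le> n" "i \<le> n" "bdry n t i = bdry n t (i + 1)"
  shows "coface_equations n i c"
proof -
  obtain v \<alpha> where c: "c = (v, \<alpha>)"
    by (cases c)
  note D = compatibleD[OF assms(1)[unfolded c]]
  consider "i = 0" | "i \<noteq> 0" "i = n" | "i \<noteq> 0" "i < n"
    using assms by linarith
  then show ?thesis
  proof cases
    case 1
    then have "t 1 = -1"
      using assms by (simp add: bdry_def split: if_splits)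
    then show ?thesis
      using 1 D(1)[of 1] D(4)[of 1] assms by (auto simp: c coface_equations_def pairs_def)
  next
    case 2
    then have "t n = 1"
      using assms by (simp add: bdry_def split: if_splits)
    then show ?thesis
      using 2 D(1)[of n] D(4)[of _ n] assms by (auto simp: c coface_equations_def pairs_def)
  next
    case 3
    then have t: "t i = t (i + 1)"
      using assms by (simp add: bdry_def split: if_splits)
    have "v (i, b) = v (i + 1, b)" if "b \<in> {i + 2..n}" for b
      using that 3 t by (intro D(5)) (auto simp: pairs_def)
    moreover have "v (a, i) = v (a, i + 1)" if "a \<in> {1..<i}" for a
      using that 3 t by (intro D(5)) (auto simp: pairs_def)
    ultimately show ?thesis
      using 3 t D(2)[of "i + 1" i] D(3)[of i "i + 1"] by (auto simp: c coface_equations_def pairs_def)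
  qed
qed

text \<open>Between two indices with equal coordinates all coordinates are equal, because \<open>t\<close> is increasing.  So
the conditions for neighbouring indices can be chained; this includes the virtual indices \<open>0\<close> and
\<open>n + 1\<close>, which give the conditions at \<open>-1\<close> and \<open>1\<close>.\<close>

lemma coface_equations_imp_compatible:
  assumes t: "t \<in> Delta n"
    and eq: "\<And>i. i \<le> n \<Longrightarrow> bdry n t i = bdry n t (i + 1) \<Longrightarrow> coface_equations n i (v, \<alpha>)"
  shows "compatible n t (v, \<alpha>)"
proof -
  have squeeze: "bdry n t j = bdry n t i" "bdry n t j = bdry n t (j + 1)"
    if "bdry n t i = bdry n t k" "i \<le> j" "j < k" "k \<le> n + 1" for i j k
    using Delta_mono[OF t, of i j] Delta_mono[OF t, of j "j + 1"] Delta_mono[OF t, of "j + 1" k] that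
    by auto
  have step: "coface_equations n j (v, \<alpha>)"
    if "bdry n t i = bdry n t k" "i \<le> j" "j < k" "k \<le> n + 1" for i j k
    using squeeze(2)[OF that] that by (intro eq) auto
  have step': "coface_equations n j (v, \<alpha>)"
    if "t i = t k" "1 \<le> i" "i \<le> j" "j < k" "k \<le> n" for i j k
    by (rule step[of i k]) (use that in \<open>auto simp: bdry_def\<close>)
  have frame: "\<alpha> b = \<alpha> a" if "t a = t b" "1 \<le> a" "a \<le> b" "b \<le> n" for a b
    using that(3)
  proof (induction a rule: inc_induct)
    case (step j)
    show ?case
      using step'[OF that(1,2) step(1,2) that(4)] step that by (auto simp: coface_equations_def)
  qed simp
  have left: "v (a, b) = v (a', b)" if "t a = t a'" "1 \<le> a" "a \<le> a'" "a' < b" "b \<le> n" for a a' b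
    using that(3)
  proof (induction a rule: inc_induct)
    case (step j)
    show ?case
      using step'[OF that(1,2) step(1,2)] step that by (auto simp: coface_equations_def)
  qed simp
  have right: "v (a, b) = v (a, b')" if "t b = t b'" "1 \<le> a" "a < b" "b \<le> b'" "b' \<le> n" for a b b'
    using that(4)
  proof (induction b rule: inc_induct)
    case (step j)
    show ?case
      using step'[OF that(1) _ step(1,2)] step that by (auto simp: coface_equations_def)
  qed simp
  have F1: "\<alpha> a = mat 1" if a: "a \<in> {1..n}" and ta: "t a = -1 \<or> t a = 1" for a
    using ta
  proof
    assume ta: "t a = -1"
    then have "coface_equations n 0 (v, \<alpha>)"
      using a by (intro step[of 0 a]) (auto simp: bdry_def)
    moreover have "t 1 = t a"
      using squeeze(1)[of 0 a 1] a ta by (cases "a = 1") (auto simp: bdry_def)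
    ultimately show ?thesis
      using frame[of 1 a] a by (auto simp: coface_equations_def)
  next
    assume ta: "t a = 1"
    then have "coface_equations n n (v, \<alpha>)"
      using a by (intro step[of a "n + 1"]) (auto simp: bdry_def)
    moreover have "t n = t a"
      using squeeze(1)[of a "n + 1" n] a ta by (auto simp: bdry_def)
    ultimately show ?thesis
      using frame[of a n] a by (auto simp: coface_equations_def)
  qed
  have F2: "\<alpha> a = \<alpha> b" if "a \<in> {1..n}" "b \<in> {1..n}" "t a = t b" for a b
    using frame[of a b] frame[of b a] that by (cases "a \<le> b") auto
  have F3: "v (a, b) = \<alpha> a *v e1" if ab: "(a, b) \<in> pairs n" and tab: "t a = t b" for a b
  proof -
    have "coface_equations n a (v, \<alpha>)"
      using step'[OF tab, of a] ab by (auto simp: pairs_def)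
    then have "v (a, a + 1) = \<alpha> a *v e1"
      using ab by (auto simp: coface_equations_def pairs_def)
    moreover have "bdry n t (a + 1) = bdry n t b"
      using squeeze(2)[of a b a] ab tab by (auto simp: bdry_def pairs_def)
    ultimately show ?thesis
      using right[of "a + 1" b a] ab by (auto simp: bdry_def pairs_def)
  qed
  have F4: "v (a, b) = e1" if ab: "(a, b) \<in> pairs n" and tab: "t a = -1 \<or> t b = 1" for a b
    using tab
  proof
    assume ta: "t a = -1"
    then have "coface_equations n 0 (v, \<alpha>)"
      using ab by (intro step[of 0 a]) (auto simp: bdry_def pairs_def)
    moreover have "t 1 = t a"
      using squeeze(1)[of 0 a 1] ab ta by (cases "a = 1") (auto simp: bdry_def pairs_def)
    ultimately show ?thesis
      using left[of 1 a b] ab by (auto simp: coface_equations_def pairs_def)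
  next
    assume tb: "t b = 1"
    then have "coface_equations n n (v, \<alpha>)"
      using ab by (intro step[of b "n + 1"]) (auto simp: bdry_def pairs_def)
    moreover have "t n = t b"
      using squeeze(1)[of b "n + 1" n] ab tb by (auto simp: bdry_def pairs_def)
    ultimately show ?thesis
      using right[of b n a] ab by (auto simp: coface_equations_def pairs_def)
  qed
  have F5: "v (a, b) = v (a', b')"
    if ab: "(a, b) \<in> pairs n" "(a', b') \<in> pairs n" and eqs: "t a = t a'" "t b = t b'" for a b a' b'
  proof -
    \<comment> \<open>Moving the endpoints apart, never towards each other, keeps the first index below the second.\<close>
    have *: "v (x, y) = v (min a a', max b b')"
      if "(x, y) \<in> pairs n" "t x = t a" "t y = t b" "min a a' \<le> x" "y \<le> max b b'" for x y
    proof -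
      have "v (x, y) = v (x, max b b')"
        using that ab eqs by (intro right) (auto simp: pairs_def max_def)
      also have "\<dots> = v (min a a', max b b')"
        using that ab eqs by (intro left[symmetric]) (auto simp: pairs_def max_def min_def)
      finally show ?thesis .
    qed
    show ?thesis
      using *[OF ab(1)] *[OF ab(2)] eqs by simp
  qed
  show ?thesis
    by (rule compatibleI) (fact F1 F2 F3 F4 F5)+
qed

lemma AM_set_eq:
  "AM_set n = {\<phi> \<in> Map_set (Delta_top n) (Cfr_top n). \<forall>t\<in>Delta n. compatible n t (\<phi> t)}"
proof -
  have "(\<forall>i\<in>{0..n}. bdry n t i = bdry n t (i + 1) \<longrightarrow> \<phi> t \<in> coface n i ` topspace (Cfr_top (n - 1)))
      \<longleftrightarrow> compatible n t (\<phi> t)"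
    if \<phi>: "\<phi> \<in> Map_set (Delta_top n) (Cfr_top n)" and t: "t \<in> Delta n" for \<phi> t
  proof -
    have c: "\<phi> t \<in> topspace (Cfr_top n)"
      using \<phi> t by (auto simp: Map_set_def continuous_map_def)
    have n: "1 \<le> n" if "i \<le> n" "bdry n t i = bdry n t (i + 1)" for i
      using that by (cases n) (auto simp: bdry_def)
    have "(\<forall>i\<in>{0..n}. bdry n t i = bdry n t (i + 1) \<longrightarrow> \<phi> t \<in> coface n i ` topspace (Cfr_top (n - 1)))
      \<longleftrightarrow> (\<forall>i\<in>{0..n}. bdry n t i = bdry n t (i + 1) \<longrightarrow> coface_equations n i (\<phi> t))"
      using in_coface_image_iff[OF n _ c] by auto
    also have "\<dots> \<longleftrightarrow> compatible n t (\<phi> t)"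
      using compatible_imp_coface_equations[of n t "\<phi> t"] n
        coface_equations_imp_compatible[OF t, of "fst (\<phi> t)" "snd (\<phi> t)"] by auto
    finally show ?thesis .
  qed
  then show ?thesis
    unfolding AM_set_def by blast
qed

section \<open>Grafting one configuration into another\<close>

text \<open>The configuration \<open>c = (u, \<beta>)\<close> inserted into \<open>d = (w, \<gamma>)\<close>.  The additive formula for the directions
replaces the case distinction between points of the same cluster and points of different clusters.\<close>

definition graft :: "nat \<Rightarrow> directions \<times> frames \<Rightarrow> directions \<times> frames \<Rightarrow> directions \<times> frames" where
  "graft n = (\<lambda>(u, \<beta>) (w, \<gamma>).
     (\<lambda>(a, b)\<in>pairs n. w (a, b) + \<gamma> a *v (u (a, b) - e1), \<lambda>a\<in>{1..n}. \<gamma> a ** \<beta> a))"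

definition endpoint_preserving :: "(real \<Rightarrow> real) \<Rightarrow> bool" where
  "endpoint_preserving k \<longleftrightarrow> k \<in> {-1..1} \<rightarrow> {-1..1} \<and> mono_on {-1..1} k \<and> k (-1) = -1 \<and> k 1 = 1"

text \<open>The clusters formed by \<open>r\<close> contain everything that \<open>k\<close> sees: if \<open>x\<close> and \<open>y\<close> are not in the same cluster,
then \<open>k\<close> moves one of them to the end of the interval that makes the direction between them \<open>e\<^sub>1\<close>.\<close>

definition collapses_middle :: "(real \<Rightarrow> real) \<Rightarrow> (real \<Rightarrow> real) \<Rightarrow> bool" where
  "collapses_middle k r \<longleftrightarrow>
     (\<forall>x\<in>{-1..1}. \<forall>y\<in>{-1..1}. x \<le> y \<longrightarrow> k x = -1 \<or> k y = 1 \<or> r x = r y)"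

lemma compose_endpoint_preserving_in_Delta:
  "t \<in> Delta n \<Longrightarrow> endpoint_preserving k \<Longrightarrow> compose {1..n} k t \<in> Delta n"
  by (rule compose_in_Delta) (auto simp: endpoint_preserving_def)

lemma compatible_graft:
  assumes k: "endpoint_preserving k" and r: "endpoint_preserving r"
    and c: "compatible n (compose {1..n} k t) c" and d: "compatible n (compose {1..n} r t) d"
  shows "compatible n t (graft n c d)"
proof -
  obtain u \<beta> w \<gamma> where cd: "c = (u, \<beta>)" "d = (w, \<gamma>)"
    by (cases c; cases d)
  note C = compatibleD[OF c[unfolded cd]] and D = compatibleD[OF d[unfolded cd]]
  have ends: "k (-1) = -1" "r (-1) = -1" "k 1 = 1" "r 1 = 1"
    using k r by (auto simp: endpoint_preserving_def)
  have pairs: "a \<in> {1..n} \<and> b \<in> {1..n}" if "(a, b) \<in> pairs n" for a b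
    using that by (auto simp: pairs_def)
  have G1: "\<gamma> a ** \<beta> a = mat 1" if "a \<in> {1..n}" "t a = -1 \<or> t a = 1" for a
    using that C(1)[of a] D(1)[of a] ends by (auto simp: compose_def)
  have G2: "\<gamma> a ** \<beta> a = \<gamma> b ** \<beta> b" if "a \<in> {1..n}" "b \<in> {1..n}" "t a = t b" for a b
    using that C(2)[of a b] D(2)[of a b] by (auto simp: compose_def)
  have G3: "w (a, b) + \<gamma> a *v (u (a, b) - e1) = (\<gamma> a ** \<beta> a) *v e1"
    if ab: "(a, b) \<in> pairs n" "t a = t b" for a b
    using C(3)[OF ab(1)] D(3)[OF ab(1)] pairs[OF ab(1)] ab(2)
    by (simp add: compose_def matrix_vector_mult_diff_distrib matrix_vector_mul_assoc)
  have G4: "w (a, b) + \<gamma> a *v (u (a, b) - e1) = e1"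
    if ab: "(a, b) \<in> pairs n" "t a = -1 \<or> t b = 1" for a b
    using C(4)[OF ab(1)] D(4)[OF ab(1)] pairs[OF ab(1)] ab(2) ends
    by (auto simp: compose_def)
  have G5: "w (a, b) + \<gamma> a *v (u (a, b) - e1) = w (a', b') + \<gamma> a' *v (u (a', b') - e1)"
    if ab: "(a, b) \<in> pairs n" "(a', b') \<in> pairs n" "t a = t a'" "t b = t b'" for a b a' b'
    using C(5)[OF ab(1,2)] D(5)[OF ab(1,2)] D(2)[of a a'] pairs[OF ab(1)] pairs[OF ab(2)] ab(3,4)
    by (auto simp: compose_def)
  have graft: "graft n c d = (\<lambda>(a, b)\<in>pairs n. w (a, b) + \<gamma> a *v (u (a, b) - e1), \<lambda>a\<in>{1..n}. \<gamma> a ** \<beta> a)"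
    by (simp add: graft_def cd)
  show ?thesis
    unfolding graft
  proof (rule compatibleI)
    fix a b assume ab: "(a, b) \<in> pairs n" "t a = t b"
    then show "(\<lambda>(a, b)\<in>pairs n. w (a, b) + \<gamma> a *v (u (a, b) - e1)) (a, b) = (\<lambda>a\<in>{1..n}. \<gamma> a ** \<beta> a) a *v e1"
      using G3[OF ab] pairs[OF ab(1)] by simp
  next
    fix a b a' b' assume ab: "(a, b) \<in> pairs n" "(a', b') \<in> pairs n" "t a = t a'" "t b = t b'"
    then show "(\<lambda>(a, b)\<in>pairs n. w (a, b) + \<gamma> a *v (u (a, b) - e1)) (a, b)
      = (\<lambda>(a, b)\<in>pairs n. w (a, b) + \<gamma> a *v (u (a, b) - e1)) (a', b')"
      using G5[OF ab] by simp
  next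
    fix a b assume ab: "a \<in> {1..n}" "b \<in> {1..n}" "t a = t b"
    then show "(\<lambda>a\<in>{1..n}. \<gamma> a ** \<beta> a) a = (\<lambda>a\<in>{1..n}. \<gamma> a ** \<beta> a) b"
      using G2[OF ab] by simp
  qed (simp_all add: G1 G4)
qed

text \<open>A graft is an operadic insertion whose clusters are the sets of indices with equal \<open>r\<close>-coordinates.
The least index of each cluster serves as its representative \<open>q a\<close>.  Compatibility of \<open>d\<close> allows
passing from \<open>a\<close> to \<open>q a\<close>, and compatibility of \<open>c\<close> gives \<open>u\<^sub>a\<^sub>b = e\<^sub>1\<close> between different clusters.\<close>

lemma graft_in_Cfr_top:
  assumes t: "t \<in> Delta n" and r: "endpoint_preserving r" and kr: "collapses_middle k r"
    and c: "c \<in> topspace (Cfr_top n)" "compatible n (compose {1..n} k t) c"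
    and d: "d \<in> topspace (Cfr_top n)" "compatible n (compose {1..n} r t) d"
  shows "graft n c d \<in> topspace (Cfr_top n)"
proof -
  obtain u \<beta> w \<gamma> where cd: "c = (u, \<beta>)" "d = (w, \<gamma>)"
    by (cases c; cases d)
  note C = compatibleD[OF c(2)[unfolded cd]] and D = compatibleD[OF d(2)[unfolded cd]]
  have uw: "u \<in> C_set n" "w \<in> C_set n"
    and orth: "\<And>a. a \<in> {1..n} \<Longrightarrow> orthogonal_matrix (\<beta> a)" "\<And>a. a \<in> {1..n} \<Longrightarrow> orthogonal_matrix (\<gamma> a)"
    using c(1) d(1) by (auto simp: cd topspace_Cfr_top PiE_def Pi_iff)
  define s where "s = compose {1..n} r t"
  have s: "s \<in> Delta n"
    unfolding s_def by (rule compose_endpoint_preserving_in_Delta[OF t r])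
  define q where "q a = (LEAST a'. a' \<in> {1..n} \<and> s a' = s a)" for a
  have q: "q a \<in> {1..n}" "s (q a) = s a" if "a \<in> {1..n}" for a
    using LeastI[of "\<lambda>a'. a' \<in> {1..n} \<and> s a' = s a" a] that unfolding q_def by auto
  have q_eq: "q a = q b" if "s a = s b" for a b
    using that by (simp add: q_def)
  have q_less: "q a < q b" if "a \<in> {1..n}" "b \<in> {1..n}" "a < b" "s a \<noteq> s b" for a b
    using Delta_le[OF s, of a b] Delta_le[OF s, of "q b" "q a"] q[of a] q[of b] that by force
  have "(\<lambda>(a, b)\<in>pairs n. if q a = q b then \<gamma> (q a) *v u (a, b) else w (q a, q b)) \<in> C_set n"
  proof (rule C_set_substitute[OF uw orth(2)])
    show "mono_on {1..n} q"
    proof (rule mono_onI)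
      fix a b assume "a \<in> {1..n}" "b \<in> {1..n}" "a \<le> b"
      then show "q a \<le> q b"
        using q_eq[of a b] q_less[of a b] by (cases "a = b"; cases "s a = s b") auto
    qed
  qed (use q in auto)
  moreover have "w (a, b) + \<gamma> a *v (u (a, b) - e1) = (if q a = q b then \<gamma> (q a) *v u (a, b) else w (q a, q b))"
    if ab: "(a, b) \<in> pairs n" for a b
  proof -
    have a: "a \<in> {1..n}" and b: "b \<in> {1..n}" and "a < b"
      using ab by (auto simp: pairs_def)
    show ?thesis
    proof (cases "s a = s b")
      case True
      have "w (a, b) = \<gamma> a *v e1"
        using D(3)[OF ab] True by (simp add: s_def)
      moreover have "\<gamma> (q a) = \<gamma> a"
        using D(2)[OF q(1)[OF a] a] q(2)[OF a] by (simp add: s_def)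
      ultimately show ?thesis
        using q_eq[OF True] by (simp add: matrix_vector_mult_diff_distrib)
    next
      case False
      have "t a \<le> t b" "t a \<in> {-1..1}" "t b \<in> {-1..1}"
        using Delta_le[OF t, of a b] Delta_range[OF t] a b \<open>a < b\<close> by auto
      then have "k (t a) = -1 \<or> k (t b) = 1"
        using kr False a b unfolding collapses_middle_def s_def compose_def by (metis restrict_apply')
      then have "u (a, b) = e1"
        using C(4)[OF ab] a b by (simp add: compose_def)
      moreover have "w (a, b) = w (q a, q b)"
        using D(5)[OF ab, of "q a" "q b"] q[OF a] q[OF b] q_less[OF a b \<open>a < b\<close> False]
        by (simp add: s_def pairs_def)
      ultimately show ?thesis
        using q_less[OF a b \<open>a < b\<close> False] by simp
    qed
  qed
  then have "(\<lambda>(a, b)\<in>pairs n. w (a, b) + \<gamma> a *v (u (a, b) - e1))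
      = (\<lambda>(a, b)\<in>pairs n. if q a = q b then \<gamma> (q a) *v u (a, b) else w (q a, q b))"
    by (auto intro!: restrict_ext)
  ultimately have "(\<lambda>(a, b)\<in>pairs n. w (a, b) + \<gamma> a *v (u (a, b) - e1)) \<in> C_set n"
    by (simp only:)
  then show ?thesis
    using orth by (auto simp: cd graft_def topspace_Cfr_top orthogonal_matrix_mul)
qed

text \<open>If the interval of \<open>c\<close> lies to the right of the interval of \<open>d\<close>, then at each point of the line one of
the two frames is the identity, and each direction is \<open>e\<^sub>1\<close> in at least one of the two
configurations; both grafts then have the remaining direction.\<close>

lemma graft_commute:
  assumes t: "t \<in> Delta n" and k: "mono_on {-1..1} k" "k \<in> {-1..1} \<rightarrow> {-1..1}"
    and disjoint: "\<And>x. x \<in> {-1..1} \<Longrightarrow> k x = -1 \<or> l x = 1"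
    and c: "compatible n (compose {1..n} k t) c" and d: "compatible n (compose {1..n} l t) d"
  shows "graft n c d = graft n d c"
proof -
  obtain u \<beta> w \<gamma> where cd: "c = (u, \<beta>)" "d = (w, \<gamma>)"
    by (cases c; cases d)
  note C = compatibleD[OF c[unfolded cd]] and D = compatibleD[OF d[unfolded cd]]
  have frame: "\<beta> a = mat 1 \<or> \<gamma> a = mat 1" if "a \<in> {1..n}" for a
    using disjoint[OF Delta_range[OF t that]] C(1)[OF that] D(1)[OF that] that by (auto simp: compose_def)
  have "w (a, b) + \<gamma> a *v (u (a, b) - e1) = u (a, b) + \<beta> a *v (w (a, b) - e1)"
    if ab: "(a, b) \<in> pairs n" for a b
  proof -
    have a: "a \<in> {1..n}" and b: "b \<in> {1..n}" and "a < b"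
      using ab by (auto simp: pairs_def)
    have ta: "t a \<in> {-1..1}" and tb: "t b \<in> {-1..1}" and le: "t a \<le> t b"
      using Delta_le[OF t, of a b] Delta_range[OF t] a b \<open>a < b\<close> by auto
    consider "k (t b) = -1" | "l (t b) = 1" "k (t a) = -1" | "l (t b) = 1" "l (t a) = 1"
      using disjoint[OF ta] disjoint[OF tb] by blast
    then show ?thesis
    proof cases
      case 1
      then have "k (t a) = -1"
        using mono_onD[OF k(1) ta tb le] k(2) ta by (auto simp: Pi_iff intro: antisym)
      then show ?thesis
        using C(1)[OF a] C(4)[OF ab] a by (simp add: compose_def)
    next
      case 2
      then show ?thesis
        using C(4)[OF ab] D(4)[OF ab] a b by (simp add: compose_def)
    next
      case 3
      then show ?thesis
        using D(1)[OF a] D(4)[OF ab] a b by (simp add: compose_def)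
    qed
  qed
  then show ?thesis
    using frame by (fastforce simp: graft_def cd intro!: restrict_ext)
qed

section \<open>Continuity of grafting\<close>

lemma continuous_map_Cfr_coordinates:
  assumes f: "continuous_map X (Cfr_top n) f"
  shows "p \<in> pairs n \<Longrightarrow> continuous_map X euclidean (\<lambda>x. fst (f x) p)"
    and "a \<in> {1..n} \<Longrightarrow> continuous_map X euclidean (\<lambda>x. snd (f x) a)"
proof -
  have fst: "continuous_map X (C_top n) (\<lambda>x. fst (f x))"
    and snd: "continuous_map X (product_topology (\<lambda>_. top_of_set {A. orthogonal_matrix A}) {1..n}) (\<lambda>x. snd (f x))"
    using f unfolding Cfr_top_def continuous_map_pairwise by (auto simp: o_def)
  show "continuous_map X euclidean (\<lambda>x. fst (f x) p)" if "p \<in> pairs n"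
    using continuous_map_compose[OF continuous_map_into_fulltopology[OF fst[unfolded C_top_def]]
        continuous_map_sphere_power_coordinate[OF that]]
    by (simp add: o_def)
  show "continuous_map X euclidean (\<lambda>x. snd (f x) a)" if "a \<in> {1..n}"
    using snd that unfolding continuous_map_componentwise continuous_map_in_subtopology by simp
qed

lemma continuous_map_into_Cfr_top:
  assumes mem: "\<And>x. x \<in> topspace X \<Longrightarrow> f x \<in> topspace (Cfr_top n)"
    and v: "\<And>a b. (a, b) \<in> pairs n \<Longrightarrow> continuous_map X euclidean (\<lambda>x. fst (f x) (a, b))"
    and \<alpha>: "\<And>a. a \<in> {1..n} \<Longrightarrow> continuous_map X euclidean (\<lambda>x. snd (f x) a)"
  shows "continuous_map X (Cfr_top n) f"
proof -
  have mem': "fst (f x) \<in> C_set n" "snd (f x) \<in> PiE {1..n} (\<lambda>_. {A. orthogonal_matrix A})"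
    if "x \<in> topspace X" for x
    using mem[OF that] by (auto simp: topspace_Cfr_top mem_Times_iff)
  have "continuous_map X (sphere_power n) (\<lambda>x. fst (f x))"
    using mem'(1) C_set_subset by (intro continuous_map_into_sphere_power v) blast
  then have "continuous_map X (C_top n) (\<lambda>x. fst (f x))"
    using mem'(1) by (auto simp: C_top_def continuous_map_in_subtopology)
  moreover have "continuous_map X (product_topology (\<lambda>_. top_of_set {A. orthogonal_matrix A}) {1..n}) (\<lambda>x. snd (f x))"
    unfolding continuous_map_componentwise
  proof (intro conjI ballI)
    show "(\<lambda>x. snd (f x)) ` topspace X \<subseteq> extensional {1..n}"
      using mem'(2) by (auto simp: PiE_def)
    fix a assume a: "a \<in> {1..n}"
    show "continuous_map X (top_of_set {A. orthogonal_matrix A}) (\<lambda>x. snd (f x) a)"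
      unfolding continuous_map_in_subtopology using \<alpha>[OF a] mem'(2) a by (auto simp: PiE_def Pi_iff)
  qed
  ultimately show ?thesis
    by (simp add: Cfr_top_def continuous_map_pairwise o_def)
qed

lemma continuous_map_matrix_vector_mult:
  fixes A :: "'a \<Rightarrow> real^'n^'m"
  assumes "continuous_map X euclidean A" "continuous_map X euclidean v"
  shows "continuous_map X euclidean (\<lambda>x. A x *v v x)"
  using assms unfolding continuous_map_atin limitin_canonical_iff matrix_vector_mult_def
  by (auto intro!: tendsto_intros)

lemma continuous_map_matrix_mult:
  fixes A :: "'a \<Rightarrow> real^'n^'m" and B :: "'a \<Rightarrow> real^'k^'n"
  assumes "continuous_map X euclidean A" "continuous_map X euclidean B"
  shows "continuous_map X euclidean (\<lambda>x. A x ** B x)"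
  using assms unfolding continuous_map_atin limitin_canonical_iff matrix_matrix_mult_def
  by (auto intro!: tendsto_intros)

lemma continuous_map_graft:
  assumes f: "continuous_map X (Cfr_top n) f" and g: "continuous_map X (Cfr_top n) g"
    and mem: "\<And>x. x \<in> topspace X \<Longrightarrow> graft n (f x) (g x) \<in> topspace (Cfr_top n)"
  shows "continuous_map X (Cfr_top n) (\<lambda>x. graft n (f x) (g x))"
proof (rule continuous_map_into_Cfr_top[OF mem])
  fix a b assume ab: "(a, b) \<in> pairs n"
  then have "a \<in> {1..n}"
    by (auto simp: pairs_def)
  with ab show "continuous_map X euclidean (\<lambda>x. fst (graft n (f x) (g x)) (a, b))"
    by (auto simp: graft_def case_prod_unfold intro!: continuous_map_add continuous_map_diff
        continuous_map_matrix_vector_mult continuous_map_Cfr_coordinates[OF f] continuous_map_Cfr_coordinates[OF g])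
next
  fix a assume "a \<in> {1..n}"
  then show "continuous_map X euclidean (\<lambda>x. snd (graft n (f x) (g x)) a)"
    by (auto simp: graft_def case_prod_unfold intro!: continuous_map_matrix_mult
        continuous_map_Cfr_coordinates[OF f] continuous_map_Cfr_coordinates[OF g])
qed

section \<open>Sliding one interval past the other\<close>

definition trunc :: "real \<Rightarrow> real" where
  "trunc x = max (-1) (min 1 x)"

text \<open>The interval of \<open>\<phi>\<close> has core \<open>[c - 1/4, c + 1/4]\<close>, which \<open>inner_coord c\<close> stretches onto \<open>[-1, 1]\<close>.  In
\<open>outer_coord c\<close>, subtracting \<open>inner_coord c x\<close> contracts this core to a point and closes the gap, and
the shift \<open>2 * c\<close> is chosen so that at \<open>c = -1/2\<close> and \<open>c = 1/2\<close> the result is the coordinate of the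
opposite interval.\<close>

definition inner_coord :: "real \<Rightarrow> real \<Rightarrow> real" where
  "inner_coord c x = trunc (4 * (x - c))"

definition outer_coord :: "real \<Rightarrow> real \<Rightarrow> real" where
  "outer_coord c x = trunc (4 * x + 2 * c - inner_coord c x)"

lemma endpoint_preserving_inner_coord: "c \<in> {-1/2..1/2} \<Longrightarrow> endpoint_preserving (inner_coord c)"
  by (auto simp: endpoint_preserving_def inner_coord_def trunc_def mono_on_def)

lemma endpoint_preserving_outer_coord: "c \<in> {-1/2..1/2} \<Longrightarrow> endpoint_preserving (outer_coord c)"
  by (auto simp: endpoint_preserving_def outer_coord_def inner_coord_def trunc_def mono_on_def min_def max_def)

lemma collapses_middle_inner_outer: "collapses_middle (inner_coord c) (outer_coord c)"
  by (auto simp: collapses_middle_def outer_coord_def inner_coord_def trunc_def min_def max_def)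

lemma outer_start: "outer_coord (-1/2) = inner_coord (1/2)"
  by (rule ext) (simp add: outer_coord_def inner_coord_def trunc_def min_def max_def)

lemma outer_end: "outer_coord (1/2) = inner_coord (-1/2)"
  by (rule ext) (simp add: outer_coord_def inner_coord_def trunc_def min_def max_def)

lemma kappa_eq_trunc:
  assumes "fst L < snd L"
  shows "kappa L x = trunc ((2 * x - fst L - snd L) / (snd L - fst L))"
proof -
  let ?y = "(2 * x - fst L - snd L) / (snd L - fst L)"
  have y: "affine_bij L ?y = x"
    using assms by (simp add: affine_bij_def field_simps)
  have inj: "inj_on (affine_bij L) {-1..1}"
    using assms by (auto simp: inj_on_def affine_bij_def)
  have "inv_into {-1..1} (affine_bij L) x = ?y" if "?y \<in> {-1..1}"
    using inv_into_f_eq[OF inj that y] .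
  moreover have "x < fst L \<longleftrightarrow> ?y < -1" "x > snd L \<longleftrightarrow> ?y > 1"
    using assms by (auto simp: field_simps)
  ultimately show ?thesis
    unfolding kappa_def trunc_def by (auto simp: min_def max_def)
qed

lemma kappa_core:
  assumes "fst L < snd L"
  shows "kappa (core L) x = trunc (4 * (x - (fst L + snd L) / 2) / (snd L - fst L))"
proof -
  have "fst (core L) < snd (core L)"
    using assms by (simp add: core_def affine_bij_def field_simps)
  moreover have "(2 * x - fst (core L) - snd (core L)) / (snd (core L) - fst (core L))
      = 4 * (x - (fst L + snd L) / 2) / (snd L - fst L)"
    using assms by (simp add: core_def affine_bij_def field_simps)
  ultimately show ?thesis
    by (simp add: kappa_eq_trunc)
qed

lemma kappa_core_left: "kappa (core (-1, 0)) = inner_coord (-1/2)"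
  by (rule ext) (simp add: kappa_core inner_coord_def)

lemma kappa_core_right: "kappa (core (0, 1)) = inner_coord (1/2)"
  by (rule ext) (simp add: kappa_core inner_coord_def)

text \<open>A collapsing map for the left half is the identity to the right of \<open>0\<close>, so by monotonicity it keeps the
left half to the left of \<open>0\<close>, where \<open>inner_coord (1/2)\<close> is constant.\<close>

lemma inner_after_collapse:
  assumes f: "collapse_map (-1, 0) f" and x: "x \<in> {-1..1}"
  shows "inner_coord (1/2) (f x) = inner_coord (1/2) x"
proof (cases "x \<le> 0")
  case False
  then show ?thesis
    using f x by (auto simp: collapse_map_def)
next
  case True
  have "f x \<le> 0"
  proof (rule ccontr)
    assume pos: "\<not> f x \<le> 0"
    have fx: "f x \<le> 1"
      using f x by (auto simp: collapse_map_def Pi_iff)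
    \<comment> \<open>If \<open>f x\<close> were positive, \<open>f x / 2\<close> would be a fixed point of \<open>f\<close> between \<open>x\<close> and \<open>f x\<close>.\<close>
    then have "f x \<le> f (f x / 2)"
      using f x True pos by (intro mono_onD[of "{-1..1}" f]) (auto simp: collapse_map_def)
    also have "f (f x / 2) = f x / 2"
      using f fx pos by (auto simp: collapse_map_def)
    finally show False
      using pos by simp
  qed
  then show ?thesis
    using True by (simp add: inner_coord_def trunc_def)
qed

lemma collapse_map_const:
  assumes f: "collapse_map (-1, 0) f" and "x \<le> y" "inner_coord (-1/2) x \<noteq> -1" "inner_coord (-1/2) y \<noteq> 1"
  shows "f x = f y"
proof -
  have "x \<in> {-3/4..-1/4}" "y \<in> {-3/4..-1/4}"
    using assms(2-) by (auto simp: inner_coord_def trunc_def min_def max_def split: if_splits)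
  then show ?thesis
    using f by (simp add: collapse_map_def core_def affine_bij_def)
qed

lemma AM_setD:
  assumes "\<phi> \<in> AM_set n" "t \<in> Delta n"
  shows "\<phi> t \<in> topspace (Cfr_top n)" "compatible n t (\<phi> t)"
  using assms unfolding AM_set_eq by (auto simp: Map_set_def continuous_map_def Pi_iff)

text \<open>The collapsing map drops out: a pair of points that it identifies without both lying in the core still
gets the direction \<open>w\<^sub>a\<^sub>b\<close>, because there \<open>u\<^sub>a\<^sub>b = e\<^sub>1\<close> and \<open>w\<^sub>a\<^sub>b = \<gamma>\<^sub>a e\<^sub>1\<close>.\<close>

lemma mu_eq_graft:
  assumes f: "collapse_map (-1, 0) (e (-1, 0))" and t: "t \<in> Delta n"
    and \<phi>: "\<phi> \<in> AM_set n" and \<psi>: "\<psi> \<in> AM_set n"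
  shows "mu n e \<phi> \<psi> t =
    graft n (\<phi> (compose {1..n} (inner_coord (-1/2)) t)) (\<psi> (compose {1..n} (inner_coord (1/2)) t))"
proof -
  let ?k = "compose {1..n} (inner_coord (-1/2)) t" and ?l = "compose {1..n} (inner_coord (1/2)) t"
  let ?s = "compose {1..n} (e (-1, 0)) t"
  obtain u \<beta> w \<gamma> where eqs: "\<phi> ?k = (u, \<beta>)" "\<psi> ?l = (w, \<gamma>)"
    by (cases "\<phi> ?k"; cases "\<psi> ?l")
  have l: "compose {1..n} (inner_coord (1/2)) ?s = ?l"
    using inner_after_collapse[OF f Delta_range[OF t]] by (auto simp: compose_def restrict_def fun_eq_iff)
  have "?k \<in> Delta n" "?l \<in> Delta n"
    by (rule compose_endpoint_preserving_in_Delta[OF t endpoint_preserving_inner_coord]; simp)+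
  then have c: "compatible n ?k (u, \<beta>)" and d: "compatible n ?l (w, \<gamma>)"
    using AM_setD(2)[OF \<phi>] AM_setD(2)[OF \<psi>] eqs by metis+
  have direction: "(if ?s a = ?s b then \<gamma> a *v u (a, b) else w (a, b)) = w (a, b) + \<gamma> a *v (u (a, b) - e1)"
    if ab: "(a, b) \<in> pairs n" for a b
  proof -
    have a: "a \<in> {1..n}" and b: "b \<in> {1..n}" and "a < b"
      using ab by (auto simp: pairs_def)
    show ?thesis
    proof (cases "?s a = ?s b")
      case True
      then have "?l a = ?l b"
        using a b unfolding l[symmetric] by (simp add: compose_def)
      then show ?thesis
        using True compatibleD(3)[OF d ab] by (simp add: matrix_vector_mult_diff_distrib)
    next
      case False
      then have "?k a = -1 \<or> ?k b = 1"
        using collapse_map_const[OF f, of "t a" "t b"] Delta_le[OF t, of a b] a b \<open>a < b\<close>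
        by (auto simp: compose_def)
      then show ?thesis
        using False compatibleD(4)[OF c ab] by simp
    qed
  qed
  have directions: "(\<lambda>(a, b)\<in>pairs n. if ?s a = ?s b then \<gamma> a *v u (a, b) else w (a, b))
      = (\<lambda>(a, b)\<in>pairs n. w (a, b) + \<gamma> a *v (u (a, b) - e1))"
  proof (rule restrict_ext)
    fix p assume "p \<in> pairs n"
    then show "(case p of (a, b) \<Rightarrow> if ?s a = ?s b then \<gamma> a *v u (a, b) else w (a, b))
        = (case p of (a, b) \<Rightarrow> w (a, b) + \<gamma> a *v (u (a, b) - e1))"
      by (cases p) (simp only: prod.case direction)
  qed
  show ?thesis
    by (simp only: mu_def mu_gen_def restrict_apply'[OF t] kappa_core_left kappa_core_right eqs
        Let_def prod.case l directions graft_def)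
qed

lemma continuous_map_AM_evaluation:
  assumes "continuous_map X (AM_top n) F" "continuous_map X (Delta_top n) T"
  shows "continuous_map X (Cfr_top n) (\<lambda>x. F x (T x))"
proof -
  have "continuous_map X (prod_topology (compact_open_topology (Delta_top n) (Cfr_top n)) (Delta_top n)) (\<lambda>x. (F x, T x))"
    using assms by (auto simp: AM_top_def continuous_map_pairwise o_def continuous_map_in_subtopology)
  from continuous_map_compose[OF this continuous_map_evaluation[OF Delta_neighbourhood_base]]
  show ?thesis
    by (simp add: o_def)
qed

definition sliding_product :: "nat \<Rightarrow> real \<Rightarrow> ((nat \<Rightarrow> real) \<Rightarrow> directions \<times> frames) \<Rightarrow>
    ((nat \<Rightarrow> real) \<Rightarrow> directions \<times> frames) \<Rightarrow> (nat \<Rightarrow> real) \<Rightarrow> directions \<times> frames" where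
  "sliding_product n c \<phi> \<psi> = (\<lambda>t\<in>Delta n.
     graft n (\<phi> (compose {1..n} (inner_coord c) t)) (\<psi> (compose {1..n} (outer_coord c) t)))"

lemma topspace_AM_top: "topspace (AM_top n) = AM_set n"
  by (auto simp: AM_top_def AM_set_def)

text \<open>By the exponential law it suffices that the value at \<open>t\<close> depends continuously on \<open>c\<close>, \<open>\<phi>\<close>, \<open>\<psi>\<close> and
\<open>t\<close> jointly.\<close>

lemma continuous_map_sliding_product:
  "continuous_map (prod_topology (top_of_set {-1/2..1/2}) (prod_topology (AM_top n) (AM_top n))) (AM_top n)
     (\<lambda>(c, \<phi>, \<psi>). sliding_product n c \<phi> \<psi>)"
  (is "continuous_map ?Z _ ?h")
proof -
  have Zc: "continuous_map ?Z euclideanreal fst"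
    using continuous_map_into_fulltopology[OF continuous_map_fst] .
  let ?X = "prod_topology ?Z (Delta_top n)"
  have good: "graft n (\<phi> (compose {1..n} (inner_coord c) t)) (\<psi> (compose {1..n} (outer_coord c) t)) \<in> topspace (Cfr_top n)"
    "compatible n t (graft n (\<phi> (compose {1..n} (inner_coord c) t)) (\<psi> (compose {1..n} (outer_coord c) t)))"
    if "c \<in> {-1/2..1/2}" "\<phi> \<in> AM_set n" "\<psi> \<in> AM_set n" "t \<in> Delta n" for c \<phi> \<psi> t
  proof -
    note ep = endpoint_preserving_inner_coord[OF that(1)] endpoint_preserving_outer_coord[OF that(1)]
    note D = compose_endpoint_preserving_in_Delta[OF that(4) ep(1)] compose_endpoint_preserving_in_Delta[OF that(4) ep(2)]
    show "graft n (\<phi> (compose {1..n} (inner_coord c) t)) (\<psi> (compose {1..n} (outer_coord c) t)) \<in> topspace (Cfr_top n)"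
      using that D by (intro graft_in_Cfr_top[OF that(4) ep(2) collapses_middle_inner_outer] AM_setD)
    show "compatible n t (graft n (\<phi> (compose {1..n} (inner_coord c) t)) (\<psi> (compose {1..n} (outer_coord c) t)))"
      using that D by (intro compatible_graft[OF ep] AM_setD)
  qed
  have c: "continuous_map ?X euclideanreal (\<lambda>p. fst (fst p))"
    using continuous_map_compose[OF continuous_map_fst Zc] by (simp add: o_def)
  have t: "continuous_map ?X euclideanreal (\<lambda>p. snd p a)" if "a \<in> {1..n}" for a
    using continuous_map_compose[OF continuous_map_snd continuous_map_Delta_coordinate[OF that]]
    by (simp add: o_def)
  have trunc: "continuous_map ?X euclideanreal (\<lambda>p. trunc (f p))" if "continuous_map ?X euclideanreal f" for f
    unfolding trunc_def using that by (intro continuous_map_real_max continuous_map_real_min) auto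
  have ci: "continuous_map ?X euclideanreal (\<lambda>p. inner_coord (fst (fst p)) (snd p a))" if "a \<in> {1..n}" for a
    unfolding inner_coord_def using c t[OF that]
    by (intro trunc continuous_map_real_mult_left continuous_map_diff)
  have co: "continuous_map ?X euclideanreal (\<lambda>p. outer_coord (fst (fst p)) (snd p a))" if "a \<in> {1..n}" for a
    unfolding outer_coord_def using c t[OF that] ci[OF that]
    by (intro trunc continuous_map_real_mult_left continuous_map_diff continuous_map_add)
  have inner: "continuous_map ?X (Delta_top n) (\<lambda>p. compose {1..n} (inner_coord (fst (fst p))) (snd p))"
  proof (rule continuous_map_into_Delta)
    show "compose {1..n} (inner_coord (fst (fst p))) (snd p) \<in> Delta n" if "p \<in> topspace ?X" for p
      using that by (intro compose_endpoint_preserving_in_Delta endpoint_preserving_inner_coord) auto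
  qed (use ci in \<open>simp add: compose_def\<close>)
  have outer: "continuous_map ?X (Delta_top n) (\<lambda>p. compose {1..n} (outer_coord (fst (fst p))) (snd p))"
  proof (rule continuous_map_into_Delta)
    show "compose {1..n} (outer_coord (fst (fst p))) (snd p) \<in> Delta n" if "p \<in> topspace ?X" for p
      using that by (intro compose_endpoint_preserving_in_Delta endpoint_preserving_outer_coord) auto
  qed (use co in \<open>simp add: compose_def\<close>)
  have \<phi>: "continuous_map ?X (AM_top n) (\<lambda>p. fst (snd (fst p)))"
    and \<psi>: "continuous_map ?X (AM_top n) (\<lambda>p. snd (snd (fst p)))"
    using continuous_map_compose[OF continuous_map_compose[OF continuous_map_fst continuous_map_snd] continuous_map_fst]
      continuous_map_compose[OF continuous_map_compose[OF continuous_map_fst continuous_map_snd] continuous_map_snd]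
    by (simp_all add: o_def)
  have "continuous_map ?X (Cfr_top n) (\<lambda>p. graft n (fst (snd (fst p)) (compose {1..n} (inner_coord (fst (fst p))) (snd p)))
      (snd (snd (fst p)) (compose {1..n} (outer_coord (fst (fst p))) (snd p))))"
    using good
    by (intro continuous_map_graft continuous_map_AM_evaluation \<phi> \<psi> inner outer) (auto simp: topspace_AM_top)
  then have "continuous_map ?X (Cfr_top n) (\<lambda>(z, t). ?h z t)"
    by (rule continuous_map_eq) (auto simp: sliding_product_def)
  then have cont: "continuous_map ?Z (compact_open_topology (Delta_top n) (Cfr_top n)) ?h"
    by (rule continuous_map_into_compact_open) (auto simp: sliding_product_def)
  have "?h z \<in> AM_set n" if z: "z \<in> topspace ?Z" for z
  proof -
    have "?h z \<in> topspace (compact_open_topology (Delta_top n) (Cfr_top n))"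
      by (rule subsetD[OF continuous_map_image_subset_topspace[OF cont] imageI[OF z]])
    then show ?thesis
      using good(2) z by (auto simp: AM_set_eq sliding_product_def topspace_AM_top)
  qed
  then show ?thesis
    using cont by (auto simp: AM_top_def continuous_map_in_subtopology)
qed

text \<open>The slide starts at \<open>\<phi> \<cdot> \<psi>\<close> by \<open>mu_eq_graft\<close> and ends at the graft of \<open>\<phi>\<close>, now on the right, into \<open>\<psi>\<close>,
now on the left; by \<open>graft_commute\<close> this is the graft of \<open>\<psi>\<close> into \<open>\<phi>\<close>, that is \<open>\<psi> \<cdot> \<phi>\<close>.\<close>

theorem theorem4p9:
  fixes n :: nat and e :: "interval \<Rightarrow> real \<Rightarrow> real"
  assumes "\<And>L. subinterval L \<Longrightarrow> collapse_map L (e L)"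
  shows "homotopic_with (\<lambda>_. True) (prod_topology (AM_top n) (AM_top n)) (AM_top n)
           (\<lambda>(\<phi>, \<psi>). mu n e \<phi> \<psi>) (\<lambda>(\<phi>, \<psi>). mu n e \<psi> \<phi>)"
proof -
  have e: "collapse_map (-1, 0) (e (-1, 0))"
    by (rule assms) (simp add: subinterval_def)
  have ext: "mu n e \<phi> \<psi> \<in> extensional (Delta n)" for \<phi> \<psi>
    by (simp add: mu_def mu_gen_def)
  have start: "sliding_product n (-1/2) \<phi> \<psi> = mu n e \<phi> \<psi>" if "\<phi> \<in> AM_set n" "\<psi> \<in> AM_set n" for \<phi> \<psi>
  proof (rule extensionalityI[of _ "Delta n"])
    show "sliding_product n (-1/2) \<phi> \<psi> t = mu n e \<phi> \<psi> t" if t: "t \<in> Delta n" for t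
      by (simp only: sliding_product_def outer_start restrict_apply'[OF t]
          mu_eq_graft[where e = e, OF e t \<open>\<phi> \<in> AM_set n\<close> \<open>\<psi> \<in> AM_set n\<close>])
  qed (use ext in \<open>auto simp: sliding_product_def\<close>)
  have finish: "sliding_product n (1/2) \<phi> \<psi> = mu n e \<psi> \<phi>" if "\<phi> \<in> AM_set n" "\<psi> \<in> AM_set n" for \<phi> \<psi>
  proof (rule extensionalityI[of _ "Delta n"])
    fix t assume t: "t \<in> Delta n"
    have ep: "endpoint_preserving (inner_coord (1/2))" "endpoint_preserving (inner_coord (-1/2))"
      by (simp_all add: endpoint_preserving_inner_coord)
    note c = AM_setD(2)[OF that(1) compose_endpoint_preserving_in_Delta[OF t ep(1)]]
      and d = AM_setD(2)[OF that(2) compose_endpoint_preserving_in_Delta[OF t ep(2)]]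
    have disjoint: "inner_coord (1/2) x = -1 \<or> inner_coord (-1/2) x = 1" for x
      by (simp add: inner_coord_def trunc_def min_def max_def)
    have "graft n (\<phi> (compose {1..n} (inner_coord (1/2)) t)) (\<psi> (compose {1..n} (inner_coord (-1/2)) t))
      = graft n (\<psi> (compose {1..n} (inner_coord (-1/2)) t)) (\<phi> (compose {1..n} (inner_coord (1/2)) t))"
      by (rule graft_commute[OF t _ _ disjoint c d]) (use ep(1) in \<open>simp_all only: endpoint_preserving_def\<close>)
    then show "sliding_product n (1/2) \<phi> \<psi> t = mu n e \<psi> \<phi> t"
      using mu_eq_graft[where e = e, OF e t that(2,1)] t by (simp only: sliding_product_def outer_end restrict_apply')
  qed (use ext in \<open>auto simp: sliding_product_def\<close>)
  let ?h = "\<lambda>(\<tau>, \<phi>, \<psi>). sliding_product n (\<tau> - 1/2) \<phi> \<psi>"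
  have shift: "continuous_map (top_of_set {0..1}) (top_of_set {-1/2..1/2}) (\<lambda>\<tau>::real. \<tau> - 1/2)"
    by (auto simp: continuous_map_in_subtopology intro!: continuous_intros)
  have "continuous_map (prod_topology (top_of_set {0..1}) (prod_topology (AM_top n) (AM_top n)))
      (prod_topology (top_of_set {-1/2..1/2}) (prod_topology (AM_top n) (AM_top n)))
      (\<lambda>(\<tau>::real, z). (\<tau> - 1/2, z))"
    using shift by (auto simp: continuous_map_prod_top)
  from continuous_map_compose[OF this continuous_map_sliding_product]
  have "continuous_map (prod_topology (top_of_set {0..1}) (prod_topology (AM_top n) (AM_top n))) (AM_top n) ?h"
    by (simp add: o_def case_prod_unfold)
  then show ?thesis
    unfolding homotopic_with[of _ "\<lambda>_. True", OF refl]
    using start finish by (intro exI[of _ ?h]) (auto simp: topspace_AM_top)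
qed

end
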